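(* Let $(A_1,\cdot_1,\circ_1)$ and $(A_2,\cdot_2,\circ_2)$ be two transposed Novikov-Poisson algebras over $\mathbf{k}$. Define two binary operations $\cdot$ and $\circ$ on $A_1\otimes A_2$ by $$(a_1\otimes a_2)\cdot(b_1\otimes b_2)=(a_1\cdot_1 b_1)\otimes(a_2\cdot_2 b_2),$$ $$(a_1\otimes a_2)\circ(b_1\otimes b_2)=(a_1\cdot_1 b_1)\otimes(a_2\circ_2 b_2)+(a_1\circ_1 b_1)\otimes(a_2\cdot_2 b_2)$$ for all $a_1,b_1\in A_1$ and $a_2,b_2\in A_2$ (extended bilinearly). Then $(A_1\otimes A_2,\cdot,\circ)$ is a transposed Novikov-Poisson algebra.
   Context: $\mathbf{k}$ is a field of characteristic not equal to $2$; tensor products are over $\mathbf{k}$, all binary operations are $\mathbf{k}$-bilinear and algebras need not be unital. A (left) Novikov algebra $(A,\circ)$ is a vector space with a binary operation satisfying $(x\circ y)\circ z=(x\circ z)\circ y$ and $(x\circ y)\circ z-x\circ(y\circ z)=(y\circ x)\circ z-y\circ(x\circ z)$ for all $x,y,z$. A transposed Novikov-Poisson algebra is a triple $(A,\cdot,\circ)$ where $(A,\cdot)$ is a commutative associative algebra, $(A,\circ)$ is a Novikov algebra, and for all $x,y,z\in A$: $(x\cdot y)\circ z=(x\cdot z)\circ y$ and $2z\cdot(x\circ y)=(z\cdot x)\circ y+x\circ(z\cdot y)$. *)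

theory Defs
  imports "HOL-Algebra.Module" "HOL-Algebra.QuotRing"
begin

text \<open>The analogue of \<^const>\<open>semiring_char\<close> for rings with an explicit carrier.\<close>

definition ring_char :: "('k, 'r) ring_scheme \<Rightarrow> nat" where
  "ring_char R = Gcd {n. [n] \<cdot>\<^bsub>R\<^esub> \<one>\<^bsub>R\<^esub> = \<zero>\<^bsub>R\<^esub>}"


section \<open>Transposed Novikov-Poisson algebras\<close>

text \<open>
  A vector space over a field \<open>R\<close> is a \<^locale>\<open>module\<close> over \<open>R\<close>. The record type of modules
  also has the fields \<^const>\<open>mult\<close> and \<^const>\<open>one\<close>, on which \<^locale>\<open>module\<close> imposes nothing;
  they are never used for the modules below. The (in general non-unital) algebra operations are
  separate binary functions, of which only the values on the carrier matter.
\<close>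

definition bilinear_map ::
  "('k, 'r) ring_scheme \<Rightarrow> ('k, 'a, 'm) module_scheme \<Rightarrow> ('k, 'b, 'n) module_scheme \<Rightarrow>
   ('k, 'c, 'p) module_scheme \<Rightarrow> ('a \<Rightarrow> 'b \<Rightarrow> 'c) \<Rightarrow> bool" where
  "bilinear_map R M N P f \<longleftrightarrow>
     (\<forall>x\<in>carrier M. \<forall>y\<in>carrier N. f x y \<in> carrier P) \<and>
     (\<forall>x\<in>carrier M. \<forall>x'\<in>carrier M. \<forall>y\<in>carrier N. f (x \<oplus>\<^bsub>M\<^esub> x') y = f x y \<oplus>\<^bsub>P\<^esub> f x' y) \<and>
     (\<forall>x\<in>carrier M. \<forall>y\<in>carrier N. \<forall>y'\<in>carrier N. f x (y \<oplus>\<^bsub>N\<^esub> y') = f x y \<oplus>\<^bsub>P\<^esub> f x y') \<and>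
     (\<forall>r\<in>carrier R. \<forall>x\<in>carrier M. \<forall>y\<in>carrier N. f (r \<odot>\<^bsub>M\<^esub> x) y = r \<odot>\<^bsub>P\<^esub> f x y) \<and>
     (\<forall>r\<in>carrier R. \<forall>x\<in>carrier M. \<forall>y\<in>carrier N. f x (r \<odot>\<^bsub>N\<^esub> y) = r \<odot>\<^bsub>P\<^esub> f x y)"

locale nonunital_algebra = field R + module R A
  for R (structure) and A (structure) +
  fixes prd :: "'c \<Rightarrow> 'c \<Rightarrow> 'c"
  assumes bilinear: "bilinear_map R A A A prd"

locale comm_assoc_algebra = nonunital_algebra +
  assumes comm: "\<lbrakk>x \<in> carrier A; y \<in> carrier A\<rbrakk> \<Longrightarrow> prd x y = prd y x"
    and assoc: "\<lbrakk>x \<in> carrier A; y \<in> carrier A; z \<in> carrier A\<rbrakk> \<Longrightarrow>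
      prd (prd x y) z = prd x (prd y z)"

locale novikov_algebra = nonunital_algebra +
  assumes right_comm: "\<lbrakk>x \<in> carrier A; y \<in> carrier A; z \<in> carrier A\<rbrakk> \<Longrightarrow>
      prd (prd x y) z = prd (prd x z) y"
    and left_symm: "\<lbrakk>x \<in> carrier A; y \<in> carrier A; z \<in> carrier A\<rbrakk> \<Longrightarrow>
      prd (prd x y) z \<ominus>\<^bsub>A\<^esub> prd x (prd y z) = prd (prd y x) z \<ominus>\<^bsub>A\<^esub> prd y (prd x z)"

locale transposed_novikov_poisson =
  comm_assoc_algebra R A dot + novikov_algebra R A circ
  for R (structure) and A (structure) and dot and circ +
  assumes dot_circ: "\<lbrakk>x \<in> carrier A; y \<in> carrier A; z \<in> carrier A\<rbrakk> \<Longrightarrow>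
      circ (dot x y) z = circ (dot x z) y"
    and compat: "\<lbrakk>x \<in> carrier A; y \<in> carrier A; z \<in> carrier A\<rbrakk> \<Longrightarrow>
      [(2::nat)] \<cdot>\<^bsub>A\<^esub> dot z (circ x y) = circ (dot z x) y \<oplus>\<^bsub>A\<^esub> circ x (dot z y)"


section \<open>Tensor products of modules\<close>

text \<open>Finitely supported functions from \<open>X\<close> to \<open>R\<close>, extended by zero outside \<open>X\<close>.\<close>

definition free_module :: "('k, 'r) ring_scheme \<Rightarrow> 'x set \<Rightarrow> ('k, 'x \<Rightarrow> 'k) module" where
  "free_module R X = \<lparr>
     carrier = {f. (\<forall>x. f x \<in> carrier R) \<and> (\<forall>x. x \<notin> X \<longrightarrow> f x = \<zero>\<^bsub>R\<^esub>) \<and> finite {x. f x \<noteq> \<zero>\<^bsub>R\<^esub>}},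
     mult = undefined,
     one = undefined,
     zero = (\<lambda>_. \<zero>\<^bsub>R\<^esub>),
     add = (\<lambda>f g x. f x \<oplus>\<^bsub>R\<^esub> g x),
     smult = (\<lambda>r f x. r \<otimes>\<^bsub>R\<^esub> f x)\<rparr>"

definition free_gen :: "('k, 'r) ring_scheme \<Rightarrow> 'x \<Rightarrow> 'x \<Rightarrow> 'k" where
  "free_gen R x = (\<lambda>y. if y = x then \<one>\<^bsub>R\<^esub> else \<zero>\<^bsub>R\<^esub>)"

definition submodule_span ::
  "('k, 'r) ring_scheme \<Rightarrow> ('k, 'a, 'm) module_scheme \<Rightarrow> 'a set \<Rightarrow> 'a set" where
  "submodule_span R M S = \<Inter> {H. submodule H R M \<and> S \<subseteq> H}"

text \<open>
  The scalar multiple of a coset \<open>C\<close> is the coset \<open>H + r x\<close> for any \<open>x \<in> C\<close>; as with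
  \<^const>\<open>rcoset_mult\<close> for ideals it is the union over all \<open>x\<close>, because the elementwise
  image of \<open>C\<close> is only \<open>{0}\<close> when \<open>r = 0\<close>.
\<close>

definition quotient_module ::
  "('k, 'a, 'm) module_scheme \<Rightarrow> 'a set \<Rightarrow> ('k, 'a set) module" where
  "quotient_module M H = \<lparr>
     carrier = a_rcosets\<^bsub>M\<^esub> H,
     mult = undefined,
     one = undefined,
     zero = H,
     add = (\<lambda>C D. C <+>\<^bsub>M\<^esub> D),
     smult = (\<lambda>r C. \<Union>x\<in>C. H +>\<^bsub>M\<^esub> (r \<odot>\<^bsub>M\<^esub> x))\<rparr>"

definition tensor_relations ::
  "('k, 'r) ring_scheme \<Rightarrow> ('k, 'a, 'm) module_scheme \<Rightarrow> ('k, 'b, 'n) module_scheme \<Rightarrow>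
   ('a \<times> 'b \<Rightarrow> 'k) set" where
  "tensor_relations R M N =
    (let F = free_module R (carrier M \<times> carrier N); \<delta> = free_gen R in
      {\<delta> (a \<oplus>\<^bsub>M\<^esub> a', b) \<ominus>\<^bsub>F\<^esub> (\<delta> (a, b) \<oplus>\<^bsub>F\<^esub> \<delta> (a', b)) | a a' b.
         a \<in> carrier M \<and> a' \<in> carrier M \<and> b \<in> carrier N} \<union>
      {\<delta> (a, b \<oplus>\<^bsub>N\<^esub> b') \<ominus>\<^bsub>F\<^esub> (\<delta> (a, b) \<oplus>\<^bsub>F\<^esub> \<delta> (a, b')) | a b b'.
         a \<in> carrier M \<and> b \<in> carrier N \<and> b' \<in> carrier N} \<union>
      {\<delta> (r \<odot>\<^bsub>M\<^esub> a, b) \<ominus>\<^bsub>F\<^esub> r \<odot>\<^bsub>F\<^esub> \<delta> (a, b) | r a b.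
         r \<in> carrier R \<and> a \<in> carrier M \<and> b \<in> carrier N} \<union>
      {\<delta> (a, r \<odot>\<^bsub>N\<^esub> b) \<ominus>\<^bsub>F\<^esub> r \<odot>\<^bsub>F\<^esub> \<delta> (a, b) | r a b.
         r \<in> carrier R \<and> a \<in> carrier M \<and> b \<in> carrier N})"

definition tensor_kernel ::
  "('k, 'r) ring_scheme \<Rightarrow> ('k, 'a, 'm) module_scheme \<Rightarrow> ('k, 'b, 'n) module_scheme \<Rightarrow>
   ('a \<times> 'b \<Rightarrow> 'k) set" where
  "tensor_kernel R M N =
     submodule_span R (free_module R (carrier M \<times> carrier N)) (tensor_relations R M N)"

definition tensor_module ::
  "('k, 'r) ring_scheme \<Rightarrow> ('k, 'a, 'm) module_scheme \<Rightarrow> ('k, 'b, 'n) module_scheme \<Rightarrow>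
   ('k, ('a \<times> 'b \<Rightarrow> 'k) set) module" where
  "tensor_module R M N =
     quotient_module (free_module R (carrier M \<times> carrier N)) (tensor_kernel R M N)"

definition pure_tensor ::
  "('k, 'r) ring_scheme \<Rightarrow> ('k, 'a, 'm) module_scheme \<Rightarrow> ('k, 'b, 'n) module_scheme \<Rightarrow>
   'a \<Rightarrow> 'b \<Rightarrow> ('a \<times> 'b \<Rightarrow> 'k) set" where
  "pure_tensor R M N a b =
     tensor_kernel R M N +>\<^bsub>free_module R (carrier M \<times> carrier N)\<^esub> free_gen R (a, b)"


section \<open>The operations on the tensor product\<close>

text \<open>
  The two operations are given by their values on pure tensors and bilinear extension. The
  following predicates say that a binary function is such an extension; pure tensors span the
  tensor product, so this determines its values on the carrier.
\<close>

definition is_tensor_dot ::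
  "('k, 'r) ring_scheme \<Rightarrow>
   ('k, 'a, 'm) module_scheme \<Rightarrow> ('a \<Rightarrow> 'a \<Rightarrow> 'a) \<Rightarrow>
   ('k, 'b, 'n) module_scheme \<Rightarrow> ('b \<Rightarrow> 'b \<Rightarrow> 'b) \<Rightarrow>
   (('a \<times> 'b \<Rightarrow> 'k) set \<Rightarrow> ('a \<times> 'b \<Rightarrow> 'k) set \<Rightarrow> ('a \<times> 'b \<Rightarrow> 'k) set) \<Rightarrow> bool" where
  "is_tensor_dot R A\<^sub>1 dot\<^sub>1 A\<^sub>2 dot\<^sub>2 dot \<longleftrightarrow>
    (let T = tensor_module R A\<^sub>1 A\<^sub>2; t = pure_tensor R A\<^sub>1 A\<^sub>2 in
      bilinear_map R T T T dot \<and>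
      (\<forall>a\<^sub>1\<in>carrier A\<^sub>1. \<forall>b\<^sub>1\<in>carrier A\<^sub>1. \<forall>a\<^sub>2\<in>carrier A\<^sub>2. \<forall>b\<^sub>2\<in>carrier A\<^sub>2.
         dot (t a\<^sub>1 a\<^sub>2) (t b\<^sub>1 b\<^sub>2) = t (dot\<^sub>1 a\<^sub>1 b\<^sub>1) (dot\<^sub>2 a\<^sub>2 b\<^sub>2)))"

definition is_tensor_circ ::
  "('k, 'r) ring_scheme \<Rightarrow>
   ('k, 'a, 'm) module_scheme \<Rightarrow> ('a \<Rightarrow> 'a \<Rightarrow> 'a) \<Rightarrow> ('a \<Rightarrow> 'a \<Rightarrow> 'a) \<Rightarrow>
   ('k, 'b, 'n) module_scheme \<Rightarrow> ('b \<Rightarrow> 'b \<Rightarrow> 'b) \<Rightarrow> ('b \<Rightarrow> 'b \<Rightarrow> 'b) \<Rightarrow>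
   (('a \<times> 'b \<Rightarrow> 'k) set \<Rightarrow> ('a \<times> 'b \<Rightarrow> 'k) set \<Rightarrow> ('a \<times> 'b \<Rightarrow> 'k) set) \<Rightarrow> bool" where
  "is_tensor_circ R A\<^sub>1 dot\<^sub>1 circ\<^sub>1 A\<^sub>2 dot\<^sub>2 circ\<^sub>2 circ \<longleftrightarrow>
    (let T = tensor_module R A\<^sub>1 A\<^sub>2; t = pure_tensor R A\<^sub>1 A\<^sub>2 in
      bilinear_map R T T T circ \<and>
      (\<forall>a\<^sub>1\<in>carrier A\<^sub>1. \<forall>b\<^sub>1\<in>carrier A\<^sub>1. \<forall>a\<^sub>2\<in>carrier A\<^sub>2. \<forall>b\<^sub>2\<in>carrier A\<^sub>2.
         circ (t a\<^sub>1 a\<^sub>2) (t b\<^sub>1 b\<^sub>2) =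
           t (dot\<^sub>1 a\<^sub>1 b\<^sub>1) (circ\<^sub>2 a\<^sub>2 b\<^sub>2) \<oplus>\<^bsub>T\<^esub> t (circ\<^sub>1 a\<^sub>1 b\<^sub>1) (dot\<^sub>2 a\<^sub>2 b\<^sub>2)))"

end

theory Submission
  imports Defs
begin

text \<open>
  The operations exist by the universal property of the tensor product, used once for each
  argument (\<open>tensor_bilinear_extension\<close>). All laws required of them are linear in each
  argument, so they only need to be checked on pure tensors (\<open>triadditive_eqI\<close>).

  On pure tensors everything rests on three expressions in a transposed Novikov-Poisson algebra,
  where juxtaposition denotes the commutative product:
  \<open>q(x,y,z) = (x y) \<circ> z\<close>, \<open>p(x;y,z) = (x \<circ> y) z\<close> and \<open>x \<circ> (y z)\<close>. The first is symmetric in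
  all arguments by commutativity and \<open>(x y) \<circ> z = (x z) \<circ> y\<close>. The compatibility law then reads
  \<open>q(x,y,z) + x \<circ> (y z) = 2 p(x;y,z)\<close> (\<open>dot_circ_sum\<close>); exchanging \<open>y\<close> and \<open>z\<close> in it and
  dividing by two shows that \<open>p(x;y,z)\<close> is symmetric in \<open>y\<close> and \<open>z\<close>
  (\<open>dot_circ_right_comm\<close>). These facts give right commutativity of \<open>\<circ>\<close> on the tensor product
  and the two mixed laws one term at a time.

  Only left symmetry needs more. In \<open>(x \<circ> y) \<circ> z - x \<circ> (y \<circ> z)\<close> the terms with \<open>x y z\<close> as one
  factor are left symmetric because the algebras are. The others are, with indices
  for the two factors,
  \<open>q\<^sub>1 \<otimes> p\<^sub>2(x;y,z) - x\<^sub>1 \<circ> (y\<^sub>1 z\<^sub>1) \<otimes> p\<^sub>2(y;x,z)\<close> and the same with the factors interchanged.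
  Replacing \<open>x \<circ> (y z)\<close> by \<open>2 p - q\<close>, the terms with \<open>q\<close> become symmetric in \<open>x\<close> and \<open>y\<close>,
  and what remains is
  \<open>- 2 p\<^sub>1(x;y,z) \<otimes> p\<^sub>2(y;x,z) - 2 p\<^sub>1(y;x,z) \<otimes> p\<^sub>2(x;y,z)\<close>, which is symmetric too
  (\<open>cross_terms\<close>).
\<close>

section \<open>Linear maps and quotient modules\<close>

definition linear_map ::
  "('k, 'r) ring_scheme \<Rightarrow> ('k, 'a, 'm) module_scheme \<Rightarrow> ('k, 'b, 'n) module_scheme \<Rightarrow>
   ('a \<Rightarrow> 'b) \<Rightarrow> bool" where
  "linear_map R M N h \<longleftrightarrow>
     (\<forall>x\<in>carrier M. h x \<in> carrier N) \<and>
     (\<forall>x\<in>carrier M. \<forall>y\<in>carrier M. h (x \<oplus>\<^bsub>M\<^esub> y) = h x \<oplus>\<^bsub>N\<^esub> h y) \<and>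
     (\<forall>r\<in>carrier R. \<forall>x\<in>carrier M. h (r \<odot>\<^bsub>M\<^esub> x) = r \<odot>\<^bsub>N\<^esub> h x)"

lemma linear_mapD:
  assumes "linear_map R M N h"
  shows "x \<in> carrier M \<Longrightarrow> h x \<in> carrier N"
    and "\<lbrakk>x \<in> carrier M; y \<in> carrier M\<rbrakk> \<Longrightarrow> h (x \<oplus>\<^bsub>M\<^esub> y) = h x \<oplus>\<^bsub>N\<^esub> h y"
    and "\<lbrakk>r \<in> carrier R; x \<in> carrier M\<rbrakk> \<Longrightarrow> h (r \<odot>\<^bsub>M\<^esub> x) = r \<odot>\<^bsub>N\<^esub> h x"
  using assms unfolding linear_map_def by blast+

lemma linear_map_abelian_group_hom:
  assumes "module R M" "module R N" "linear_map R M N h"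
  shows "abelian_group_hom M N h"
proof -
  interpret M: module R M by fact
  interpret N: module R N by fact
  show ?thesis
    by (intro abelian_group_homI M.abelian_group_axioms N.abelian_group_axioms group_hom.intro
        group_hom_axioms.intro M.a_group N.a_group homI)
      (use linear_mapD[OF assms(3)] in auto)
qed

lemma bilinear_mapD:
  assumes "bilinear_map R M N P f"
  shows "\<lbrakk>x \<in> carrier M; y \<in> carrier N\<rbrakk> \<Longrightarrow> f x y \<in> carrier P"
    and "\<lbrakk>x \<in> carrier M; x' \<in> carrier M; y \<in> carrier N\<rbrakk> \<Longrightarrow> f (x \<oplus>\<^bsub>M\<^esub> x') y = f x y \<oplus>\<^bsub>P\<^esub> f x' y"
    and "\<lbrakk>x \<in> carrier M; y \<in> carrier N; y' \<in> carrier N\<rbrakk> \<Longrightarrow> f x (y \<oplus>\<^bsub>N\<^esub> y') = f x y \<oplus>\<^bsub>P\<^esub> f x y'"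
    and "\<lbrakk>r \<in> carrier R; x \<in> carrier M; y \<in> carrier N\<rbrakk> \<Longrightarrow> f (r \<odot>\<^bsub>M\<^esub> x) y = r \<odot>\<^bsub>P\<^esub> f x y"
    and "\<lbrakk>r \<in> carrier R; x \<in> carrier M; y \<in> carrier N\<rbrakk> \<Longrightarrow> f x (r \<odot>\<^bsub>N\<^esub> y) = r \<odot>\<^bsub>P\<^esub> f x y"
  using assms unfolding bilinear_map_def by blast+

lemma (in module) submodule_imp_abelian_subgroup:
  assumes "submodule H R M"
  shows "abelian_subgroup H M"
  by (rule abelian_subgroupI3[OF additive_subgroupI[OF submodule.axioms(1)[OF assms]] abelian_group_axioms])

context module
begin

lemma quotient_module_add:
  assumes "submodule H R M" "x \<in> carrier M" "y \<in> carrier M"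
  shows "(H +>\<^bsub>M\<^esub> x) \<oplus>\<^bsub>quotient_module M H\<^esub> (H +>\<^bsub>M\<^esub> y) = H +>\<^bsub>M\<^esub> (x \<oplus>\<^bsub>M\<^esub> y)"
  by (simp add: quotient_module_def
      abelian_subgroup.a_rcos_sum[OF submodule_imp_abelian_subgroup[OF assms(1)] assms(2,3)])

lemma quotient_module_smult:
  assumes H: "submodule H R M" and r: "r \<in> carrier R" and x: "x \<in> carrier M"
  shows "r \<odot>\<^bsub>quotient_module M H\<^esub> (H +>\<^bsub>M\<^esub> x) = H +>\<^bsub>M\<^esub> (r \<odot>\<^bsub>M\<^esub> x)"
proof -
  interpret H: abelian_subgroup H M by (rule submodule_imp_abelian_subgroup[OF H])
  have eq: "H +>\<^bsub>M\<^esub> (r \<odot>\<^bsub>M\<^esub> y) = H +>\<^bsub>M\<^esub> (r \<odot>\<^bsub>M\<^esub> x)" if "y \<in> H +>\<^bsub>M\<^esub> x" for y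
  proof -
    obtain h where h: "h \<in> H" "y = h \<oplus>\<^bsub>M\<^esub> x"
      using \<open>y \<in> H +>\<^bsub>M\<^esub> x\<close> by (auto simp: a_r_coset_def')
    have "r \<odot>\<^bsub>M\<^esub> h \<in> H" using submodule.smult_closed[OF H r] h by blast
    then have "r \<odot>\<^bsub>M\<^esub> y \<in> H +>\<^bsub>M\<^esub> (r \<odot>\<^bsub>M\<^esub> x)"
      using h r x by (auto simp: a_r_coset_def' smult_r_distr)
    then show ?thesis using H.a_repr_independence' r x by blast
  qed
  have "x \<in> H +>\<^bsub>M\<^esub> x" by (rule H.a_rcos_self[OF x])
  then have "(\<Union>y\<in>H +>\<^bsub>M\<^esub> x. H +>\<^bsub>M\<^esub> (r \<odot>\<^bsub>M\<^esub> y)) = H +>\<^bsub>M\<^esub> (r \<odot>\<^bsub>M\<^esub> x)"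
    by (rule UN_constant_eq) (rule ballI, rule eq)
  then show ?thesis by (simp add: quotient_module_def)
qed

lemma quotient_module_cosetE:
  assumes "C \<in> carrier (quotient_module M H)"
  obtains x where "x \<in> carrier M" "C = H +>\<^bsub>M\<^esub> x"
  using assms unfolding quotient_module_def by (auto simp: A_RCOSETS_def')

lemma quotient_module_coset:
  "x \<in> carrier M \<Longrightarrow> H +>\<^bsub>M\<^esub> x \<in> carrier (quotient_module M H)"
  unfolding quotient_module_def by (auto simp: A_RCOSETS_def')

lemma module_quotient_module:
  assumes H: "submodule H R M"
  shows "module R (quotient_module M H)"
proof (rule moduleI)
  interpret H: abelian_subgroup H M by (rule submodule_imp_abelian_subgroup[OF H])
  have zero: "\<zero>\<^bsub>quotient_module M H\<^esub> = H +>\<^bsub>M\<^esub> \<zero>\<^bsub>M\<^esub>"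
    using H.a_subset by (simp add: quotient_module_def)
  show "abelian_group (quotient_module M H)"
  proof (rule abelian_groupI)
    fix C assume "C \<in> carrier (quotient_module M H)"
    then obtain x where x: "x \<in> carrier M" "C = H +>\<^bsub>M\<^esub> x" by (rule quotient_module_cosetE)
    then have "(H +>\<^bsub>M\<^esub> (\<ominus>\<^bsub>M\<^esub> x)) \<oplus>\<^bsub>quotient_module M H\<^esub> C = \<zero>\<^bsub>quotient_module M H\<^esub>"
      by (simp add: zero quotient_module_add[OF H] M.l_neg)
    then show "\<exists>D\<in>carrier (quotient_module M H). D \<oplus>\<^bsub>quotient_module M H\<^esub> C = \<zero>\<^bsub>quotient_module M H\<^esub>"
      using x quotient_module_coset M.a_inv_closed by blast
  qed (safe elim!: quotient_module_cosetE,
      simp_all add: zero quotient_module_add[OF H] quotient_module_coset M.a_ac)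
  show "cring R" by (rule R.is_cring)
next
  show "a \<odot>\<^bsub>quotient_module M H\<^esub> C \<in> carrier (quotient_module M H)"
    if "a \<in> carrier R" "C \<in> carrier (quotient_module M H)" for a C
    using that by (auto elim!: quotient_module_cosetE simp: quotient_module_smult[OF H] quotient_module_coset)
qed (safe elim!: quotient_module_cosetE, simp_all add: quotient_module_smult[OF H] quotient_module_add[OF H]
      smult_l_distr smult_r_distr smult_assoc1)

text \<open>
  The induced map evaluates \<open>h\<close> at an arbitrary representative of the coset; any two
  representatives differ by an element of \<open>H\<close>, which \<open>h\<close> kills.
\<close>

lemma quotient_module_universal:
  assumes H: "submodule H R M" and P: "module R P" and h: "linear_map R M P h"
    and H0: "\<And>x. x \<in> H \<Longrightarrow> h x = \<zero>\<^bsub>P\<^esub>"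
  obtains g where "linear_map R (quotient_module M H) P g"
    and "\<And>x. x \<in> carrier M \<Longrightarrow> g (H +>\<^bsub>M\<^esub> x) = h x"
proof -
  interpret H: abelian_subgroup H M by (rule submodule_imp_abelian_subgroup[OF H])
  interpret P: module R P by fact
  define g where "g C = h (SOME x. x \<in> C)" for C
  have g: "g (H +>\<^bsub>M\<^esub> x) = h x" if x: "x \<in> carrier M" for x
  proof -
    have "(SOME y. y \<in> H +>\<^bsub>M\<^esub> x) \<in> H +>\<^bsub>M\<^esub> x"
      using H.a_rcos_self[OF x] by (rule someI)
    then obtain k where k: "k \<in> H" "(SOME y. y \<in> H +>\<^bsub>M\<^esub> x) = k \<oplus>\<^bsub>M\<^esub> x"
      by (auto simp: a_r_coset_def')
    show ?thesis using k x linear_mapD[OF h] H0 by (simp add: g_def)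
  qed
  have "linear_map R (quotient_module M H) P g"
    unfolding linear_map_def
    by (auto elim!: quotient_module_cosetE
        simp: quotient_module_smult[OF H] quotient_module_add[OF H] g linear_mapD[OF h])
  with g show thesis using that by blast
qed

lemma submodule_zero_mem: "submodule H R M \<Longrightarrow> \<zero>\<^bsub>M\<^esub> \<in> H"
  by (rule additive_subgroup.zero_closed[OF abelian_subgroup.axioms(1)[OF submodule_imp_abelian_subgroup]])

lemma submodule_span_submodule:
  assumes "S \<subseteq> carrier M"
  shows "submodule (submodule_span R M S) R M"
proof -
  have *: "submodule (carrier M) R M" by (rule carrier_is_submodule)
  show ?thesis
    unfolding submodule_span_def
    by (rule submoduleI) (use assms * submoduleE in \<open>auto dest: submodule_zero_mem\<close>)
qed

end

lemma submodule_span_superset: "S \<subseteq> submodule_span R M S"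
  unfolding submodule_span_def by blast

lemma submodule_span_minimal:
  "\<lbrakk>submodule H R M; S \<subseteq> H\<rbrakk> \<Longrightarrow> submodule_span R M S \<subseteq> H"
  unfolding submodule_span_def by blast

text \<open>
  To see that a linear map kills the span of a set it suffices, by
  \<open>submodule_span_minimal\<close>, to see that it kills the set.
\<close>

lemma linear_map_kernel_submodule:
  assumes M: "module R M" and N: "module R N" and h: "linear_map R M N h"
  shows "submodule (a_kernel M N h) R M"
proof -
  interpret M: module R M by fact
  interpret N: module R N by fact
  have "subgroup (a_kernel M N h) (add_monoid M)"
    using abelian_group_hom.additive_subgroup_a_kernel[OF linear_map_abelian_group_hom[OF assms]]
    by (rule additive_subgroup.a_subgroup)
  then show ?thesis
    by (intro submodule.intro submodule_axioms.intro)
      (auto simp only: a_kernel_def' mem_Collect_eq linear_mapD(3)[OF h] M.smult_closed N.smult_r_null)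
qed

section \<open>Free modules\<close>

lemma free_module_simps:
  "f \<in> carrier (free_module R X) \<longleftrightarrow>
     (\<forall>x. f x \<in> carrier R) \<and> (\<forall>x. x \<notin> X \<longrightarrow> f x = \<zero>\<^bsub>R\<^esub>) \<and> finite {x. f x \<noteq> \<zero>\<^bsub>R\<^esub>}"
  "\<zero>\<^bsub>free_module R X\<^esub> = (\<lambda>_. \<zero>\<^bsub>R\<^esub>)"
  "f \<oplus>\<^bsub>free_module R X\<^esub> g = (\<lambda>x. f x \<oplus>\<^bsub>R\<^esub> g x)"
  "r \<odot>\<^bsub>free_module R X\<^esub> f = (\<lambda>x. r \<otimes>\<^bsub>R\<^esub> f x)"
  by (simp_all add: free_module_def)

context cring
begin

lemma free_module_add_closed:
  assumes "f \<in> carrier (free_module R X)" "g \<in> carrier (free_module R X)"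
  shows "f \<oplus>\<^bsub>free_module R X\<^esub> g \<in> carrier (free_module R X)"
proof -
  have "{x. f x \<oplus> g x \<noteq> \<zero>} \<subseteq> {x. f x \<noteq> \<zero>} \<union> {x. g x \<noteq> \<zero>}" by auto
  moreover have "finite ({x. f x \<noteq> \<zero>} \<union> {x. g x \<noteq> \<zero>})"
    using assms by (simp add: free_module_simps)
  ultimately have "finite {x. f x \<oplus> g x \<noteq> \<zero>}" by (rule finite_subset)
  then show ?thesis using assms by (simp add: free_module_simps)
qed

lemma free_module_smult_closed:
  assumes "r \<in> carrier R" "f \<in> carrier (free_module R X)"
  shows "r \<odot>\<^bsub>free_module R X\<^esub> f \<in> carrier (free_module R X)"
proof -
  have "{x. r \<otimes> f x \<noteq> \<zero>} \<subseteq> {x. f x \<noteq> \<zero>}" using assms by auto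
  moreover have "finite {x. f x \<noteq> \<zero>}"
    using assms by (simp add: free_module_simps)
  ultimately have "finite {x. r \<otimes> f x \<noteq> \<zero>}" by (rule finite_subset)
  then show ?thesis using assms by (simp add: free_module_simps)
qed

lemma module_free_module: "module R (free_module R X)"
proof (rule moduleI)
  show "abelian_group (free_module R X)"
  proof (rule abelian_groupI)
    fix f assume f: "f \<in> carrier (free_module R X)"
    then have "(\<ominus> \<one>) \<odot>\<^bsub>free_module R X\<^esub> f \<in> carrier (free_module R X)"
      by (simp add: free_module_smult_closed)
    moreover have "(\<ominus> \<one>) \<odot>\<^bsub>free_module R X\<^esub> f \<oplus>\<^bsub>free_module R X\<^esub> f = \<zero>\<^bsub>free_module R X\<^esub>"
      using f by (simp add: free_module_simps fun_eq_iff l_minus l_neg)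
    ultimately show "\<exists>g\<in>carrier (free_module R X). g \<oplus>\<^bsub>free_module R X\<^esub> f = \<zero>\<^bsub>free_module R X\<^esub>"
      by blast
  qed (simp_all add: free_module_add_closed, simp_all add: free_module_simps fun_eq_iff a_ac)
  show "cring R" by (rule is_cring)
qed (simp_all add: free_module_smult_closed, simp_all add: free_module_simps fun_eq_iff l_distr r_distr m_assoc)

lemma free_gen_closed: "x \<in> X \<Longrightarrow> free_gen R x \<in> carrier (free_module R X)"
  by (simp add: free_module_simps free_gen_def)

text \<open>
  Induction over a finite set containing the support: a function splits into its value at one
  point, times the generator at that point, and a function vanishing there.
\<close>

lemma free_module_induct [consumes 1, case_names zero smult_gen add]:
  assumes f: "f \<in> carrier (free_module R X)"
    and zero: "P \<zero>\<^bsub>free_module R X\<^esub>"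
    and gen: "\<And>r x. \<lbrakk>r \<in> carrier R; x \<in> X\<rbrakk> \<Longrightarrow> P (r \<odot>\<^bsub>free_module R X\<^esub> free_gen R x)"
    and add: "\<And>f g. \<lbrakk>f \<in> carrier (free_module R X); g \<in> carrier (free_module R X); P f; P g\<rbrakk>
      \<Longrightarrow> P (f \<oplus>\<^bsub>free_module R X\<^esub> g)"
  shows "P f"
proof -
  have "P f" if "finite S" "f \<in> carrier (free_module R X)" "{x. f x \<noteq> \<zero>} \<subseteq> S" for S f
    using that
  proof (induction S arbitrary: f rule: finite_induct)
    case empty
    then have "f = \<zero>\<^bsub>free_module R X\<^esub>" by (auto simp: free_module_simps)
    then show ?case using zero by simp
  next
    case (insert s S)
    show ?case
    proof (cases "s \<in> X")
      case False
      with insert.prems have "{x. f x \<noteq> \<zero>} \<subseteq> S" by (auto simp: free_module_simps)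
      then show ?thesis using insert by blast
    next
      case True
      have fs: "f s \<in> carrier R" using insert.prems by (simp add: free_module_simps)
      define g where "g = f(s := \<zero>)"
      have "{x. g x \<noteq> \<zero>} \<subseteq> {x. f x \<noteq> \<zero>}" by (auto simp: g_def)
      then have "finite {x. g x \<noteq> \<zero>}"
        using insert.prems finite_subset by (auto simp: free_module_simps)
      then have g: "g \<in> carrier (free_module R X)"
        using insert.prems by (simp add: free_module_simps g_def)
      have "P g" by (rule insert.IH[OF g]) (use insert.prems in \<open>auto simp: g_def\<close>)
      have "f = f s \<odot>\<^bsub>free_module R X\<^esub> free_gen R s \<oplus>\<^bsub>free_module R X\<^esub> g"
        using insert.prems by (auto simp: free_module_simps free_gen_def fun_eq_iff g_def)
      then show ?thesis
        using add[OF free_module_smult_closed[OF fs free_gen_closed[OF True]] g gen[OF fs True] \<open>P g\<close>]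
        by simp
    qed
  qed
  then show ?thesis using f by (auto simp: free_module_simps)
qed

text \<open>
  The extension is the finite sum of \<open>g x \<odot> f x\<close> over the support of \<open>g\<close>. Supports
  change under addition and scaling, so linearity is proved after rewriting all sums over one
  common finite set that contains the supports involved.
\<close>

lemma free_module_universal:
  assumes P: "module R P" and f: "\<And>x. x \<in> X \<Longrightarrow> f x \<in> carrier P"
  obtains h where "linear_map R (free_module R X) P h"
    and "\<And>x. x \<in> X \<Longrightarrow> h (free_gen R x) = f x"
proof -
  interpret P: module R P by fact
  define h where "h g = (\<Oplus>\<^bsub>P\<^esub>x\<in>{x. g x \<noteq> \<zero>}. g x \<odot>\<^bsub>P\<^esub> f x)" for g
  have term_closed: "g x \<odot>\<^bsub>P\<^esub> f x \<in> carrier P" if "g \<in> carrier (free_module R X)" "x \<in> X" for g x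
    using that f by (simp add: free_module_simps)
  have supp: "{x. g x \<noteq> \<zero>} \<subseteq> X" "finite {x. g x \<noteq> \<zero>}" if "g \<in> carrier (free_module R X)" for g
    using that by (auto simp: free_module_simps)
  have h_eq: "h g = (\<Oplus>\<^bsub>P\<^esub>x\<in>S. g x \<odot>\<^bsub>P\<^esub> f x)"
    if g: "g \<in> carrier (free_module R X)" and S: "finite S" "{x. g x \<noteq> \<zero>} \<subseteq> S" "S \<subseteq> X" for g S
    unfolding h_def
    by (rule P.add.finprod_mono_neutral_cong_left) (use S term_closed[OF g] f in auto)
  have add: "h (g \<oplus>\<^bsub>free_module R X\<^esub> g') = h g \<oplus>\<^bsub>P\<^esub> h g'"
    if g: "g \<in> carrier (free_module R X)" and g': "g' \<in> carrier (free_module R X)" for g g'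
  proof -
    define S where "S = {x. g x \<noteq> \<zero>} \<union> {x. g' x \<noteq> \<zero>}"
    have S: "finite S" "S \<subseteq> X" using supp[OF g] supp[OF g'] by (auto simp: S_def)
    have "h (g \<oplus>\<^bsub>free_module R X\<^esub> g') = (\<Oplus>\<^bsub>P\<^esub>x\<in>S. (g x \<oplus> g' x) \<odot>\<^bsub>P\<^esub> f x)"
      by (subst h_eq[OF free_module_add_closed[OF g g'] S(1) _ S(2)])
        (auto simp: free_module_simps S_def)
    also have "\<dots> = (\<Oplus>\<^bsub>P\<^esub>x\<in>S. g x \<odot>\<^bsub>P\<^esub> f x \<oplus>\<^bsub>P\<^esub> g' x \<odot>\<^bsub>P\<^esub> f x)"
      by (rule P.finsum_cong')
        (use S f g g' term_closed in \<open>auto simp: P.smult_l_distr free_module_simps subset_iff\<close>)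
    also have "\<dots> = (\<Oplus>\<^bsub>P\<^esub>x\<in>S. g x \<odot>\<^bsub>P\<^esub> f x) \<oplus>\<^bsub>P\<^esub> (\<Oplus>\<^bsub>P\<^esub>x\<in>S. g' x \<odot>\<^bsub>P\<^esub> f x)"
      by (rule P.finsum_addf) (use S term_closed g g' in blast)+
    also have "\<dots> = h g \<oplus>\<^bsub>P\<^esub> h g'"
      using h_eq[OF g S(1) _ S(2)] h_eq[OF g' S(1) _ S(2)] by (simp add: S_def)
    finally show ?thesis .
  qed
  have smult: "h (r \<odot>\<^bsub>free_module R X\<^esub> g) = r \<odot>\<^bsub>P\<^esub> h g"
    if r: "r \<in> carrier R" and g: "g \<in> carrier (free_module R X)" for r g
  proof -
    let ?S = "{x. g x \<noteq> \<zero>}"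
    have "h (r \<odot>\<^bsub>free_module R X\<^esub> g) = (\<Oplus>\<^bsub>P\<^esub>x\<in>?S. (r \<otimes> g x) \<odot>\<^bsub>P\<^esub> f x)"
      by (subst h_eq[OF free_module_smult_closed[OF r g] supp(2)[OF g] _ supp(1)[OF g]])
        (use r in \<open>auto simp: free_module_simps\<close>)
    also have "\<dots> = (\<Oplus>\<^bsub>P\<^esub>x\<in>?S. r \<odot>\<^bsub>P\<^esub> (g x \<odot>\<^bsub>P\<^esub> f x))"
      by (rule P.finsum_cong')
        (use r supp[OF g] f g term_closed in \<open>auto simp: P.smult_assoc1 free_module_simps subset_iff\<close>)
    also have "\<dots> = r \<odot>\<^bsub>P\<^esub> h g"
      unfolding h_def by (rule P.finsum_smult_ldistr[symmetric])
        (use r supp[OF g] term_closed[OF g] in auto)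
    finally show ?thesis .
  qed
  have closed: "h g \<in> carrier P" if "g \<in> carrier (free_module R X)" for g
    unfolding h_def by (rule P.finsum_closed) (use supp[OF that] term_closed[OF that] in auto)
  have gen: "h (free_gen R x) = f x" if x: "x \<in> X" for x
  proof -
    have "h (free_gen R x) = (\<Oplus>\<^bsub>P\<^esub>y\<in>{x}. free_gen R x y \<odot>\<^bsub>P\<^esub> f y)"
      by (rule h_eq[OF free_gen_closed[OF x]]) (use x in \<open>auto simp: free_gen_def\<close>)
    then show ?thesis using f[OF x] by (simp add: free_gen_def)
  qed
  show thesis
    by (rule that[of h]) (auto simp: linear_map_def add smult closed gen)
qed

end

section \<open>Tensor products\<close>

lemma bilinear_map_add:
  assumes P: "module R P" and f: "bilinear_map R M N P f" and g: "bilinear_map R M N P g"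
  shows "bilinear_map R M N P (\<lambda>x y. f x y \<oplus>\<^bsub>P\<^esub> g x y)"
proof -
  interpret P: module R P by fact
  show ?thesis
    unfolding bilinear_map_def
    by (simp add: bilinear_mapD[OF f] bilinear_mapD[OF g] P.a_ac P.smult_r_distr)
qed

lemma bilinear_map_compose_linear:
  assumes "bilinear_map R M' N' P f" "linear_map R M M' g" "linear_map R N N' h"
  shows "bilinear_map R M N P (\<lambda>x y. f (g x) (h y))"
  unfolding bilinear_map_def
  by (simp add: bilinear_mapD[OF assms(1)] linear_mapD[OF assms(2)] linear_mapD[OF assms(3)])

lemma bilinear_map_linear_left:
  "\<lbrakk>bilinear_map R M N P f; y \<in> carrier N\<rbrakk> \<Longrightarrow> linear_map R M P (\<lambda>x. f x y)"
  by (auto simp: bilinear_map_def linear_map_def)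

lemma bilinear_map_linear_right:
  "\<lbrakk>bilinear_map R M N P f; x \<in> carrier M\<rbrakk> \<Longrightarrow> linear_map R N P (f x)"
  by (auto simp: bilinear_map_def linear_map_def)

locale module_pair = M: module R M + N: module R N
  for R (structure) and M (structure) and N (structure)
begin

abbreviation F where "F \<equiv> free_module R (carrier M \<times> carrier N)"
abbreviation K where "K \<equiv> tensor_kernel R M N"
abbreviation T where "T \<equiv> tensor_module R M N"
abbreviation t where "t \<equiv> pure_tensor R M N"

sublocale F: module R F
  by (rule M.module_free_module)

lemma free_gen_pair_closed:
  "\<lbrakk>a \<in> carrier M; b \<in> carrier N\<rbrakk> \<Longrightarrow> free_gen R (a, b) \<in> carrier F"
  by (simp add: M.free_gen_closed)

lemma tensor_relations_cases:
  assumes "w \<in> tensor_relations R M N"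
  obtains
    (add_left) a a' b where "a \<in> carrier M" "a' \<in> carrier M" "b \<in> carrier N"
      "w = free_gen R (a \<oplus>\<^bsub>M\<^esub> a', b) \<ominus>\<^bsub>F\<^esub> (free_gen R (a, b) \<oplus>\<^bsub>F\<^esub> free_gen R (a', b))"
  | (add_right) a b b' where "a \<in> carrier M" "b \<in> carrier N" "b' \<in> carrier N"
      "w = free_gen R (a, b \<oplus>\<^bsub>N\<^esub> b') \<ominus>\<^bsub>F\<^esub> (free_gen R (a, b) \<oplus>\<^bsub>F\<^esub> free_gen R (a, b'))"
  | (smult_left) r a b where "r \<in> carrier R" "a \<in> carrier M" "b \<in> carrier N"
      "w = free_gen R (r \<odot>\<^bsub>M\<^esub> a, b) \<ominus>\<^bsub>F\<^esub> r \<odot>\<^bsub>F\<^esub> free_gen R (a, b)"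
  | (smult_right) r a b where "r \<in> carrier R" "a \<in> carrier M" "b \<in> carrier N"
      "w = free_gen R (a, r \<odot>\<^bsub>N\<^esub> b) \<ominus>\<^bsub>F\<^esub> r \<odot>\<^bsub>F\<^esub> free_gen R (a, b)"
  using assms unfolding tensor_relations_def Let_def
  by (elim UnE CollectE exE conjE) (rule that; assumption)+

lemma tensor_relations_subset: "tensor_relations R M N \<subseteq> carrier F"
proof
  fix w assume "w \<in> tensor_relations R M N"
  then show "w \<in> carrier F"
    by (cases rule: tensor_relations_cases)
      (simp_all add: free_gen_pair_closed F.minus_closed)
qed

lemma tensor_kernel_submodule: "submodule K R F"
  unfolding tensor_kernel_def by (rule F.submodule_span_submodule[OF tensor_relations_subset])

lemma relation_in_tensor_kernel: "w \<in> tensor_relations R M N \<Longrightarrow> w \<in> K"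
  unfolding tensor_kernel_def by (rule subsetD[OF submodule_span_superset])

sublocale T: module R T
  unfolding tensor_module_def by (rule F.module_quotient_module[OF tensor_kernel_submodule])

lemma tensor_coset_eqI:
  assumes "x \<in> carrier F" "y \<in> carrier F" "x \<ominus>\<^bsub>F\<^esub> y \<in> tensor_relations R M N"
  shows "K +>\<^bsub>F\<^esub> x = K +>\<^bsub>F\<^esub> y"
proof -
  interpret K: abelian_subgroup K F
    by (rule F.submodule_imp_abelian_subgroup[OF tensor_kernel_submodule])
  have "x \<oplus>\<^bsub>F\<^esub> \<ominus>\<^bsub>F\<^esub> y \<in> K"
    using relation_in_tensor_kernel[OF assms(3)] by (simp add: a_minus_def)
  then have "x \<in> K +>\<^bsub>F\<^esub> y" by (rule K.a_rcos_module_rev[OF assms(2,1)])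
  then show ?thesis using K.a_repr_independence'[OF _ assms(2)] by simp
qed

lemma bilinear_pure_tensor: "bilinear_map R M N T t"
proof -
  let ?d = "free_gen R"
  have add: "(K +>\<^bsub>F\<^esub> x) \<oplus>\<^bsub>T\<^esub> (K +>\<^bsub>F\<^esub> y) = K +>\<^bsub>F\<^esub> (x \<oplus>\<^bsub>F\<^esub> y)" if "x \<in> carrier F" "y \<in> carrier F" for x y
    unfolding tensor_module_def by (rule F.quotient_module_add[OF tensor_kernel_submodule that])
  have smult: "r \<odot>\<^bsub>T\<^esub> (K +>\<^bsub>F\<^esub> x) = K +>\<^bsub>F\<^esub> (r \<odot>\<^bsub>F\<^esub> x)" if "r \<in> carrier R" "x \<in> carrier F" for r x
    unfolding tensor_module_def by (rule F.quotient_module_smult[OF tensor_kernel_submodule that])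
  have closed: "t a b \<in> carrier T" if "a \<in> carrier M" "b \<in> carrier N" for a b
    unfolding tensor_module_def pure_tensor_def
    by (rule F.quotient_module_coset) (simp add: free_gen_pair_closed that)
  have "t (a \<oplus>\<^bsub>M\<^esub> a') b = t a b \<oplus>\<^bsub>T\<^esub> t a' b"
    if "a \<in> carrier M" "a' \<in> carrier M" "b \<in> carrier N" for a a' b
  proof -
    have "K +>\<^bsub>F\<^esub> ?d (a \<oplus>\<^bsub>M\<^esub> a', b) = K +>\<^bsub>F\<^esub> (?d (a, b) \<oplus>\<^bsub>F\<^esub> ?d (a', b))"
      by (rule tensor_coset_eqI)
        (use that in \<open>simp_all add: free_gen_pair_closed, auto simp: tensor_relations_def Let_def\<close>)
    then show ?thesis by (simp add: pure_tensor_def add free_gen_pair_closed that)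
  qed
  moreover have "t a (b \<oplus>\<^bsub>N\<^esub> b') = t a b \<oplus>\<^bsub>T\<^esub> t a b'"
    if "a \<in> carrier M" "b \<in> carrier N" "b' \<in> carrier N" for a b b'
  proof -
    have "K +>\<^bsub>F\<^esub> ?d (a, b \<oplus>\<^bsub>N\<^esub> b') = K +>\<^bsub>F\<^esub> (?d (a, b) \<oplus>\<^bsub>F\<^esub> ?d (a, b'))"
      by (rule tensor_coset_eqI)
        (use that in \<open>simp_all add: free_gen_pair_closed, auto simp: tensor_relations_def Let_def\<close>)
    then show ?thesis by (simp add: pure_tensor_def add free_gen_pair_closed that)
  qed
  moreover have "t (r \<odot>\<^bsub>M\<^esub> a) b = r \<odot>\<^bsub>T\<^esub> t a b"
    if "r \<in> carrier R" "a \<in> carrier M" "b \<in> carrier N" for r a b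
  proof -
    have "K +>\<^bsub>F\<^esub> ?d (r \<odot>\<^bsub>M\<^esub> a, b) = K +>\<^bsub>F\<^esub> (r \<odot>\<^bsub>F\<^esub> ?d (a, b))"
      by (rule tensor_coset_eqI)
        (use that in \<open>simp_all add: free_gen_pair_closed, auto simp: tensor_relations_def Let_def\<close>)
    then show ?thesis by (simp add: pure_tensor_def smult free_gen_pair_closed that)
  qed
  moreover have "t a (r \<odot>\<^bsub>N\<^esub> b) = r \<odot>\<^bsub>T\<^esub> t a b"
    if "r \<in> carrier R" "a \<in> carrier M" "b \<in> carrier N" for r a b
  proof -
    have "K +>\<^bsub>F\<^esub> ?d (a, r \<odot>\<^bsub>N\<^esub> b) = K +>\<^bsub>F\<^esub> (r \<odot>\<^bsub>F\<^esub> ?d (a, b))"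
      by (rule tensor_coset_eqI)
        (use that in \<open>simp_all add: free_gen_pair_closed, auto simp: tensor_relations_def Let_def\<close>)
    then show ?thesis by (simp add: pure_tensor_def smult free_gen_pair_closed that)
  qed
  ultimately show ?thesis using closed unfolding bilinear_map_def by simp
qed

lemmas pure_tensor_closed [simp, intro] = bilinear_mapD(1)[OF bilinear_pure_tensor]
lemmas pure_tensor_add_left = bilinear_mapD(2)[OF bilinear_pure_tensor]
lemmas pure_tensor_add_right = bilinear_mapD(3)[OF bilinear_pure_tensor]
lemmas pure_tensor_smult_left = bilinear_mapD(4)[OF bilinear_pure_tensor]

lemma pure_tensor_sum_left:
  assumes "a \<oplus>\<^bsub>M\<^esub> a' = c \<oplus>\<^bsub>M\<^esub> c'"
    and "a \<in> carrier M" "a' \<in> carrier M" "c \<in> carrier M" "c' \<in> carrier M" "b \<in> carrier N"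
  shows "t a b \<oplus>\<^bsub>T\<^esub> t a' b = t c b \<oplus>\<^bsub>T\<^esub> t c' b"
  by (simp only: pure_tensor_add_left[symmetric] assms)

lemma pure_tensor_sum_right:
  assumes "b \<oplus>\<^bsub>N\<^esub> b' = d \<oplus>\<^bsub>N\<^esub> d'"
    and "b \<in> carrier N" "b' \<in> carrier N" "d \<in> carrier N" "d' \<in> carrier N" "a \<in> carrier M"
  shows "t a b \<oplus>\<^bsub>T\<^esub> t a b' = t a d \<oplus>\<^bsub>T\<^esub> t a d'"
  by (simp only: pure_tensor_add_right[symmetric] assms)

text \<open>
  Every tensor is a sum of pure tensors alone: a scalar can be absorbed into the left factor,
  and the zero tensor is itself pure. Hence two additive maps that agree on pure tensors agree.
\<close>

lemma tensor_induct [consumes 1, case_names pure add]: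
  assumes "C \<in> carrier T"
    and pure: "\<And>a b. \<lbrakk>a \<in> carrier M; b \<in> carrier N\<rbrakk> \<Longrightarrow> P (t a b)"
    and add: "\<And>C D. \<lbrakk>C \<in> carrier T; D \<in> carrier T; P C; P D\<rbrakk> \<Longrightarrow> P (C \<oplus>\<^bsub>T\<^esub> D)"
  shows "P C"
proof -
  obtain f where f: "f \<in> carrier F" and C: "C = K +>\<^bsub>F\<^esub> f"
    using assms(1) unfolding tensor_module_def by (rule F.quotient_module_cosetE)
  have coset: "K +>\<^bsub>F\<^esub> x \<in> carrier T" if "x \<in> carrier F" for x
    unfolding tensor_module_def by (rule F.quotient_module_coset[OF that])
  from f have "P (K +>\<^bsub>F\<^esub> f)"
  proof (induction rule: M.free_module_induct)
    case zero
    have "K +>\<^bsub>F\<^esub> \<zero>\<^bsub>F\<^esub> = \<zero>\<^bsub>T\<^esub>"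
      using F.submoduleE(1)[OF tensor_kernel_submodule]
      by (simp add: tensor_module_def quotient_module_def)
    also have "\<dots> = t (\<zero> \<odot>\<^bsub>M\<^esub> \<zero>\<^bsub>M\<^esub>) \<zero>\<^bsub>N\<^esub>"
      by (subst pure_tensor_smult_left) simp_all
    finally show ?case using pure by simp
  next
    case (smult_gen r x)
    then obtain a b where x: "x = (a, b)" "a \<in> carrier M" "b \<in> carrier N" by auto
    have "K +>\<^bsub>F\<^esub> (r \<odot>\<^bsub>F\<^esub> free_gen R x) = r \<odot>\<^bsub>T\<^esub> t a b"
      unfolding tensor_module_def pure_tensor_def x(1)
      by (rule F.quotient_module_smult[OF tensor_kernel_submodule, symmetric])
        (use smult_gen x in \<open>simp_all add: free_gen_pair_closed\<close>)
    also have "\<dots> = t (r \<odot>\<^bsub>M\<^esub> a) b"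
      by (rule pure_tensor_smult_left[symmetric]) (use smult_gen x in auto)
    finally show ?case using pure x smult_gen by simp
  next
    case (add f g)
    have "K +>\<^bsub>F\<^esub> (f \<oplus>\<^bsub>F\<^esub> g) = (K +>\<^bsub>F\<^esub> f) \<oplus>\<^bsub>T\<^esub> (K +>\<^bsub>F\<^esub> g)"
      unfolding tensor_module_def
      by (rule F.quotient_module_add[OF tensor_kernel_submodule add(1,2), symmetric])
    then show ?case using assms(3)[OF coset[OF add(1)] coset[OF add(2)] add(3,4)] by simp
  qed
  then show ?thesis by (simp add: C)
qed

text \<open>
  The linear extension to the free module sends each defining relation to an instance of
  bilinearity of \<open>f\<close>, hence it kills the kernel and descends to the quotient.
\<close>

lemma tensor_universal:
  assumes P: "module R P" and f: "bilinear_map R M N P f"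
  obtains h where "linear_map R T P h"
    and "\<And>a b. \<lbrakk>a \<in> carrier M; b \<in> carrier N\<rbrakk> \<Longrightarrow> h (t a b) = f a b"
proof -
  interpret P: module R P by fact
  obtain h where h: "linear_map R F P h"
    and h_gen: "\<And>x. x \<in> carrier M \<times> carrier N \<Longrightarrow> h (free_gen R x) = case_prod f x"
    using M.free_module_universal[OF P, of "carrier M \<times> carrier N" "case_prod f"]
      bilinear_mapD(1)[OF f] by auto
  interpret h: abelian_group_hom F P h
    by (rule linear_map_abelian_group_hom[OF F.module_axioms P h])
  have "w \<in> a_kernel F P h" if w: "w \<in> tensor_relations R M N" for w
  proof -
    have "w \<in> carrier F" using w tensor_relations_subset by blast
    moreover from w have "h w = \<zero>\<^bsub>P\<^esub>"
      by (cases rule: tensor_relations_cases)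
        (simp_all add: a_minus_def free_gen_pair_closed h_gen bilinear_mapD[OF f]
          linear_mapD(3)[OF h] P.r_neg)
    ultimately show ?thesis unfolding a_kernel_def' by blast
  qed
  then have "K \<subseteq> a_kernel F P h"
    unfolding tensor_kernel_def
    by (intro submodule_span_minimal linear_map_kernel_submodule F.module_axioms P h subsetI)
  then have "h x = \<zero>\<^bsub>P\<^esub>" if "x \<in> K" for x
    using that unfolding a_kernel_def' by blast
  then obtain g where "linear_map R T P g"
    and "\<And>x. x \<in> carrier F \<Longrightarrow> g (K +>\<^bsub>F\<^esub> x) = h x"
    unfolding tensor_module_def
    using F.quotient_module_universal[OF tensor_kernel_submodule P h] by metis
  then show thesis
    using that[of g] by (simp add: pure_tensor_def free_gen_pair_closed h_gen)
qed

text \<open>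
  The universal property is used twice: first in \<open>(c, d)\<close> for each fixed \<open>(a, b)\<close>, giving
  linear maps \<open>L a b\<close>; then, for each tensor \<open>D\<close>, in \<open>(a, b)\<close> applied to
  \<open>L a b D\<close>. This gives the choice \<open>G D\<close> for every \<open>D\<close> separately, so linearity in \<open>D\<close>
  has to be recovered from the values at pure tensors.
\<close>

lemma tensor_bilinear_extension:
  assumes P: "module R P"
    and g_right: "\<And>a b. \<lbrakk>a \<in> carrier M; b \<in> carrier N\<rbrakk> \<Longrightarrow> bilinear_map R M N P (g a b)"
    and g_left: "\<And>c d. \<lbrakk>c \<in> carrier M; d \<in> carrier N\<rbrakk> \<Longrightarrow> bilinear_map R M N P (\<lambda>a b. g a b c d)"
  obtains G where "bilinear_map R T T P G"
    and "\<And>a b c d. \<lbrakk>a \<in> carrier M; b \<in> carrier N; c \<in> carrier M; d \<in> carrier N\<rbrakk>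
      \<Longrightarrow> G (t a b) (t c d) = g a b c d"
proof -
  interpret P: module R P by fact
  have "\<exists>h. a \<in> carrier M \<longrightarrow> b \<in> carrier N \<longrightarrow> linear_map R T P h \<and>
      (\<forall>c\<in>carrier M. \<forall>d\<in>carrier N. h (t c d) = g a b c d)" for a b
    using tensor_universal[OF P g_right] by metis
  then obtain L where L: "linear_map R T P (L a b)"
    and L_pure: "c \<in> carrier M \<Longrightarrow> d \<in> carrier N \<Longrightarrow> L a b (t c d) = g a b c d"
    if "a \<in> carrier M" "b \<in> carrier N" for a b c d
    by metis
  have L_bilinear: "bilinear_map R M N P (\<lambda>a b. L a b D)" if "D \<in> carrier T" for D
    using that
  proof (induction rule: tensor_induct)
    case (pure c d)
    then show ?case
      using g_left[OF pure] by (simp add: bilinear_map_def L_pure)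
  next
    case (add D E)
    then show ?case
      using bilinear_map_add[OF P add(3,4)] by (simp add: bilinear_map_def linear_mapD(2)[OF L])
  qed
  have "\<exists>h. D \<in> carrier T \<longrightarrow> linear_map R T P h \<and>
      (\<forall>a\<in>carrier M. \<forall>b\<in>carrier N. h (t a b) = L a b D)" for D
    using tensor_universal[OF P L_bilinear] by metis
  then obtain G where G: "linear_map R T P (G D)"
    and G_pure: "a \<in> carrier M \<Longrightarrow> b \<in> carrier N \<Longrightarrow> G D (t a b) = L a b D"
    if "D \<in> carrier T" for D a b
    by metis
  have add: "G (D \<oplus>\<^bsub>T\<^esub> E) C = G D C \<oplus>\<^bsub>P\<^esub> G E C"
    if "C \<in> carrier T" "D \<in> carrier T" "E \<in> carrier T" for C D E
    using that(1)
  proof (induction rule: tensor_induct)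
    case (pure a b)
    then show ?case using that by (simp add: G_pure linear_mapD(2)[OF L])
  next
    case (add C C')
    then show ?case using that by (simp add: linear_mapD[OF G] P.a_ac)
  qed
  have smult: "G (r \<odot>\<^bsub>T\<^esub> D) C = r \<odot>\<^bsub>P\<^esub> G D C"
    if "C \<in> carrier T" "r \<in> carrier R" "D \<in> carrier T" for C D r
    using that(1)
  proof (induction rule: tensor_induct)
    case (pure a b)
    then show ?case using that by (simp add: G_pure linear_mapD(3)[OF L])
  next
    case (add C C')
    then show ?case using that by (simp add: linear_mapD[OF G] P.smult_r_distr)
  qed
  have "bilinear_map R T T P (\<lambda>C D. G D C)"
    unfolding bilinear_map_def by (simp add: add smult linear_mapD[OF G])
  then show thesis by (rule that) (simp add: G_pure L_pure)
qed

end

section \<open>Trilinear identities\<close>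

text \<open>
  Both sides of each ternary law are compositions of bilinear maps, up to a permutation of the
  arguments and addition. Additivity in each argument is all that is needed to reduce such a
  law to pure tensors, and it is visibly preserved by these constructions.
\<close>

definition triadditive :: "('a, 'm) ring_scheme \<Rightarrow> ('a \<Rightarrow> 'a \<Rightarrow> 'a \<Rightarrow> 'a) \<Rightarrow> bool" where
  "triadditive A f \<longleftrightarrow>
     (\<forall>x\<in>carrier A. \<forall>y\<in>carrier A. \<forall>z\<in>carrier A. f x y z \<in> carrier A) \<and>
     (\<forall>x\<in>carrier A. \<forall>x'\<in>carrier A. \<forall>y\<in>carrier A. \<forall>z\<in>carrier A.
        f (x \<oplus>\<^bsub>A\<^esub> x') y z = f x y z \<oplus>\<^bsub>A\<^esub> f x' y z) \<and>
     (\<forall>x\<in>carrier A. \<forall>y\<in>carrier A. \<forall>y'\<in>carrier A. \<forall>z\<in>carrier A.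
        f x (y \<oplus>\<^bsub>A\<^esub> y') z = f x y z \<oplus>\<^bsub>A\<^esub> f x y' z) \<and>
     (\<forall>x\<in>carrier A. \<forall>y\<in>carrier A. \<forall>z\<in>carrier A. \<forall>z'\<in>carrier A.
        f x y (z \<oplus>\<^bsub>A\<^esub> z') = f x y z \<oplus>\<^bsub>A\<^esub> f x y z')"

lemma triadditive_compose_left:
  "\<lbrakk>bilinear_map R A A A f; bilinear_map R A A A g\<rbrakk> \<Longrightarrow> triadditive A (\<lambda>x y z. f (g x y) z)"
  by (simp add: triadditive_def bilinear_mapD)

lemma triadditive_compose_right:
  "\<lbrakk>bilinear_map R A A A f; bilinear_map R A A A g\<rbrakk> \<Longrightarrow> triadditive A (\<lambda>x y z. f x (g y z))"
  by (simp add: triadditive_def bilinear_mapD)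

lemma triadditive_swap12: "triadditive A f \<Longrightarrow> triadditive A (\<lambda>x y z. f y x z)"
  by (simp add: triadditive_def)

lemma triadditive_swap23: "triadditive A f \<Longrightarrow> triadditive A (\<lambda>x y z. f x z y)"
  by (simp add: triadditive_def)

lemma triadditive_add:
  assumes "abelian_group A" "triadditive A f" "triadditive A g"
  shows "triadditive A (\<lambda>x y z. f x y z \<oplus>\<^bsub>A\<^esub> g x y z)"
proof -
  interpret abelian_group A by fact
  show ?thesis using assms(2,3) by (simp add: triadditive_def a_ac)
qed

context module_pair
begin

lemma triadditive_eqI:
  assumes f: "triadditive T f" and g: "triadditive T g"
    and pure: "\<And>a b c d e k. \<lbrakk>a \<in> carrier M; b \<in> carrier N; c \<in> carrier M; d \<in> carrier N;
      e \<in> carrier M; k \<in> carrier N\<rbrakk> \<Longrightarrow> f (t a b) (t c d) (t e k) = g (t a b) (t c d) (t e k)"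
    and xyz: "x \<in> carrier T" "y \<in> carrier T" "z \<in> carrier T"
  shows "f x y z = g x y z"
proof -
  have 1: "f (t a b) (t c d) z = g (t a b) (t c d) z"
    if "a \<in> carrier M" "b \<in> carrier N" "c \<in> carrier M" "d \<in> carrier N" for a b c d
    using xyz(3) by (induction rule: tensor_induct) (use f g that pure in \<open>simp_all add: triadditive_def\<close>)
  have 2: "f (t a b) y z = g (t a b) y z" if "a \<in> carrier M" "b \<in> carrier N" for a b
    using xyz(2) by (induction rule: tensor_induct) (use f g that 1 xyz(3) in \<open>simp_all add: triadditive_def\<close>)
  show ?thesis
    using xyz(1) by (induction rule: tensor_induct) (use f g 2 xyz(2,3) in \<open>simp_all add: triadditive_def\<close>)
qed

end

section \<open>Transposed Novikov-Poisson algebras in characteristic different from two\<close>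

lemma (in abelian_monoid) two_add_pow: "x \<in> carrier G \<Longrightarrow> [(2::nat)] \<cdot> x = x \<oplus> x"
  by (simp add: numeral_2_eq_2 add.nat_pow_Suc)

lemma (in abelian_group) minus_eq_minus_iff:
  assumes "a \<in> carrier G" "b \<in> carrier G" "c \<in> carrier G" "d \<in> carrier G"
  shows "a \<ominus> b = c \<ominus> d \<longleftrightarrow> a \<oplus> d = c \<oplus> b"
proof -
  have "a \<ominus> b = c \<ominus> d \<longleftrightarrow> (a \<ominus> b) \<oplus> (b \<oplus> d) = (c \<ominus> d) \<oplus> (b \<oplus> d)"
    using assms by (simp add: minus_closed)
  also have "(a \<ominus> b) \<oplus> (b \<oplus> d) = a \<oplus> d"
    using assms by (simp add: a_minus_def a_assoc r_neg1)
  also have "(c \<ominus> d) \<oplus> (b \<oplus> d) = c \<oplus> b"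
    using assms by (simp add: a_minus_def a_assoc a_comm[of b d] r_neg1)
  finally show ?thesis .
qed

lemma (in field) one_plus_one_nonzero:
  assumes "ring_char R \<noteq> 2"
  shows "\<one> \<oplus> \<one> \<noteq> \<zero>"
proof
  assume 2: "\<one> \<oplus> \<one> = \<zero>"
  \<comment> \<open>The multiples of one that vanish are then exactly the even ones, so the characteristic is two.\<close>
  have "[n] \<cdot> \<one> = (if even n then \<zero> else \<one>)" for n :: nat
    by (induction n) (simp_all add: 2)
  then have "{n::nat. [n] \<cdot> \<one> = \<zero>} = {n. 2 dvd n}" by simp
  moreover have "Gcd {n::nat. 2 dvd n} = 2"
    by (rule Gcd_eqI) auto
  ultimately show False using assms by (simp add: ring_char_def)
qed

text \<open>
  In a field of characteristic different from two, \<open>1 + 1\<close> is invertible, and acting with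
  its inverse on \<open>x + x\<close> gives back \<open>x\<close>.
\<close>

lemma double_cancel:
  assumes "field R" "ring_char R \<noteq> 2" "module R M"
    and x: "x \<in> carrier M" and y: "y \<in> carrier M" and eq: "x \<oplus>\<^bsub>M\<^esub> x = y \<oplus>\<^bsub>M\<^esub> y"
  shows "x = y"
proof -
  interpret R: field R by fact
  interpret M: module R M by fact
  let ?c = "\<one>\<^bsub>R\<^esub> \<oplus>\<^bsub>R\<^esub> \<one>\<^bsub>R\<^esub>"
  have "?c \<in> Units R" using R.one_plus_one_nonzero[OF assms(2)] by (simp add: R.field_Units)
  then have inv: "inv\<^bsub>R\<^esub> ?c \<in> carrier R" "inv\<^bsub>R\<^esub> ?c \<otimes>\<^bsub>R\<^esub> ?c = \<one>\<^bsub>R\<^esub>" by simp_all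
  have half: "inv\<^bsub>R\<^esub> ?c \<odot>\<^bsub>M\<^esub> (z \<oplus>\<^bsub>M\<^esub> z) = z" if z: "z \<in> carrier M" for z
  proof -
    have "z \<oplus>\<^bsub>M\<^esub> z = ?c \<odot>\<^bsub>M\<^esub> z" using z by (simp add: M.smult_l_distr)
    then show ?thesis
      using M.smult_assoc1[OF inv(1) _ z, of ?c] inv(2) z by simp
  qed
  have "x = inv\<^bsub>R\<^esub> ?c \<odot>\<^bsub>M\<^esub> (x \<oplus>\<^bsub>M\<^esub> x)" by (rule half[OF x, symmetric])
  also have "\<dots> = y" unfolding eq by (rule half[OF y])
  finally show ?thesis .
qed

context transposed_novikov_poisson
begin

lemma bilinear_dot: "bilinear_map R A A A dot"
  by (rule nonunital_algebra.bilinear[OF comm_assoc_algebra.axioms(1)[OF comm_assoc_algebra_axioms]])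

lemma bilinear_circ: "bilinear_map R A A A circ"
  by (rule nonunital_algebra.bilinear[OF novikov_algebra.axioms(1)[OF novikov_algebra_axioms]])

lemmas dot_closed [simp] = bilinear_mapD(1)[OF bilinear_dot]
lemmas circ_closed [simp] = bilinear_mapD(1)[OF bilinear_circ]

lemma dot_left_commute:
  "\<lbrakk>x \<in> carrier A; y \<in> carrier A; z \<in> carrier A\<rbrakk> \<Longrightarrow> dot (dot x y) z = dot (dot x z) y"
  by (simp add: assoc comm[of y z])

text \<open>
  The compatibility law with the symmetry of \<open>(x y) \<circ> z\<close> put in: it expresses
  \<open>x \<circ> (y z)\<close> through \<open>(x \<circ> y) z\<close> and \<open>(x y) \<circ> z\<close>.
\<close>

lemma dot_circ_sum:
  assumes "x \<in> carrier A" "y \<in> carrier A" "z \<in> carrier A"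
  shows "circ (dot x y) z \<oplus>\<^bsub>A\<^esub> circ x (dot y z) = dot (circ x y) z \<oplus>\<^bsub>A\<^esub> dot (circ x y) z"
proof -
  have "circ (dot x y) z = circ (dot z x) y"
    using assms by (simp add: dot_circ[of x y z] comm[of x z])
  then show ?thesis
    using compat[OF assms] two_add_pow[of "dot z (circ x y)"] assms
    by (simp add: comm[of y z] comm[of "circ x y" z])
qed

text \<open>
  The left-hand side of \<open>dot_circ_sum\<close> is symmetric in \<open>y\<close> and \<open>z\<close>, so twice
  \<open>(x \<circ> y) z\<close> is symmetric as well. This is where the characteristic enters.
\<close>

lemma dot_circ_right_comm:
  assumes "ring_char R \<noteq> 2" and xyz: "x \<in> carrier A" "y \<in> carrier A" "z \<in> carrier A"
  shows "dot (circ x y) z = dot (circ x z) y"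
proof (rule double_cancel[OF field_axioms assms(1) module_axioms])
  show "dot (circ x y) z \<oplus>\<^bsub>A\<^esub> dot (circ x y) z = dot (circ x z) y \<oplus>\<^bsub>A\<^esub> dot (circ x z) y"
    using dot_circ_sum[OF xyz] dot_circ_sum[OF xyz(1,3,2)] xyz
    by (simp add: dot_circ[of x y z] comm[of y z])
qed (use xyz in simp_all)

lemma circ_left_symm_sum:
  assumes "x \<in> carrier A" "y \<in> carrier A" "z \<in> carrier A"
  shows "circ (circ x y) z \<oplus>\<^bsub>A\<^esub> circ y (circ x z) = circ (circ y x) z \<oplus>\<^bsub>A\<^esub> circ x (circ y z)"
  using left_symm[OF assms] assms by (simp add: minus_eq_minus_iff)

end

section \<open>The tensor product of two transposed Novikov-Poisson algebras\<close>

locale transposed_novikov_poisson_pair =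
  A\<^sub>1: transposed_novikov_poisson R A\<^sub>1 dot\<^sub>1 circ\<^sub>1 + A\<^sub>2: transposed_novikov_poisson R A\<^sub>2 dot\<^sub>2 circ\<^sub>2
  for R (structure) and A\<^sub>1 and dot\<^sub>1 circ\<^sub>1 and A\<^sub>2 and dot\<^sub>2 circ\<^sub>2 +
  assumes char: "ring_char R \<noteq> 2"
begin

sublocale module_pair R A\<^sub>1 A\<^sub>2
  by (intro module_pair.intro A\<^sub>1.module_axioms A\<^sub>2.module_axioms)

lemma ex_tensor_product_map:
  assumes f: "bilinear_map R A\<^sub>1 A\<^sub>1 A\<^sub>1 f" and g: "bilinear_map R A\<^sub>2 A\<^sub>2 A\<^sub>2 g"
  obtains G where "bilinear_map R T T T G"
    and "\<And>a b c d. \<lbrakk>a \<in> carrier A\<^sub>1; b \<in> carrier A\<^sub>2; c \<in> carrier A\<^sub>1; d \<in> carrier A\<^sub>2\<rbrakk>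
      \<Longrightarrow> G (t a b) (t c d) = t (f a c) (g b d)"
proof (rule tensor_bilinear_extension[OF T.module_axioms, of "\<lambda>a b c d. t (f a c) (g b d)"])
  show "bilinear_map R A\<^sub>1 A\<^sub>2 T (\<lambda>c d. t (f a c) (g b d))"
    if "a \<in> carrier A\<^sub>1" "b \<in> carrier A\<^sub>2" for a b
    by (rule bilinear_map_compose_linear[OF bilinear_pure_tensor bilinear_map_linear_right[OF f that(1)]
          bilinear_map_linear_right[OF g that(2)]])
  show "bilinear_map R A\<^sub>1 A\<^sub>2 T (\<lambda>a b. t (f a c) (g b d))"
    if "c \<in> carrier A\<^sub>1" "d \<in> carrier A\<^sub>2" for c d
    by (rule bilinear_map_compose_linear[OF bilinear_pure_tensor bilinear_map_linear_left[OF f that(1)]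
          bilinear_map_linear_left[OF g that(2)]])
qed (rule that)

lemma ex_tensor_dot: "\<exists>dot. is_tensor_dot R A\<^sub>1 dot\<^sub>1 A\<^sub>2 dot\<^sub>2 dot"
proof -
  obtain G where "bilinear_map R T T T G"
    and "\<And>a b c d. \<lbrakk>a \<in> carrier A\<^sub>1; b \<in> carrier A\<^sub>2; c \<in> carrier A\<^sub>1; d \<in> carrier A\<^sub>2\<rbrakk>
      \<Longrightarrow> G (t a b) (t c d) = t (dot\<^sub>1 a c) (dot\<^sub>2 b d)"
    by (rule ex_tensor_product_map[OF A\<^sub>1.bilinear_dot A\<^sub>2.bilinear_dot]) (rule that)
  then show ?thesis by (intro exI[of _ G]) (simp add: is_tensor_dot_def Let_def)
qed

lemma ex_tensor_circ: "\<exists>circ. is_tensor_circ R A\<^sub>1 dot\<^sub>1 circ\<^sub>1 A\<^sub>2 dot\<^sub>2 circ\<^sub>2 circ"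
proof -
  obtain G where G: "bilinear_map R T T T G"
    and G_pure: "\<And>a b c d. \<lbrakk>a \<in> carrier A\<^sub>1; b \<in> carrier A\<^sub>2; c \<in> carrier A\<^sub>1; d \<in> carrier A\<^sub>2\<rbrakk>
      \<Longrightarrow> G (t a b) (t c d) = t (dot\<^sub>1 a c) (circ\<^sub>2 b d)"
    by (rule ex_tensor_product_map[OF A\<^sub>1.bilinear_dot A\<^sub>2.bilinear_circ]) (rule that)
  obtain H where H: "bilinear_map R T T T H"
    and H_pure: "\<And>a b c d. \<lbrakk>a \<in> carrier A\<^sub>1; b \<in> carrier A\<^sub>2; c \<in> carrier A\<^sub>1; d \<in> carrier A\<^sub>2\<rbrakk>
      \<Longrightarrow> H (t a b) (t c d) = t (circ\<^sub>1 a c) (dot\<^sub>2 b d)"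
    by (rule ex_tensor_product_map[OF A\<^sub>1.bilinear_circ A\<^sub>2.bilinear_dot]) (rule that)
  have "bilinear_map R T T T (\<lambda>C D. G C D \<oplus>\<^bsub>T\<^esub> H C D)"
    by (rule bilinear_map_add[OF T.module_axioms G H])
  then show ?thesis
    by (intro exI[of _ "\<lambda>C D. G C D \<oplus>\<^bsub>T\<^esub> H C D"])
      (simp add: is_tensor_circ_def Let_def G_pure H_pure)
qed

text \<open>
  The mixed terms of left symmetry. For the two factors, \<open>q\<close> and \<open>v\<close> stand for
  \<open>(x y) \<circ> z\<close>; \<open>p\<close> and \<open>u\<close> for \<open>(x \<circ> y) z\<close>; \<open>s\<close> and \<open>w\<close> for \<open>x \<circ> (y z)\<close>;
  a prime exchanges \<open>x\<close> and \<open>y\<close>. The two halves of each side match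
  only crosswise: the left-hand side collapses to \<open>2 p' \<otimes> u + 2 p \<otimes> u'\<close> and the right-hand
  side to the same terms in the other order.
\<close>

lemma cross_terms:
  assumes "p \<in> carrier A\<^sub>1" "p' \<in> carrier A\<^sub>1" "q \<in> carrier A\<^sub>1" "s \<in> carrier A\<^sub>1" "s' \<in> carrier A\<^sub>1"
    and "u \<in> carrier A\<^sub>2" "u' \<in> carrier A\<^sub>2" "v \<in> carrier A\<^sub>2" "w \<in> carrier A\<^sub>2" "w' \<in> carrier A\<^sub>2"
    and s: "q \<oplus>\<^bsub>A\<^sub>1\<^esub> s = p \<oplus>\<^bsub>A\<^sub>1\<^esub> p" "q \<oplus>\<^bsub>A\<^sub>1\<^esub> s' = p' \<oplus>\<^bsub>A\<^sub>1\<^esub> p'"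
    and w: "v \<oplus>\<^bsub>A\<^sub>2\<^esub> w = u \<oplus>\<^bsub>A\<^sub>2\<^esub> u" "v \<oplus>\<^bsub>A\<^sub>2\<^esub> w' = u' \<oplus>\<^bsub>A\<^sub>2\<^esub> u'"
  shows "(t q u \<oplus>\<^bsub>T\<^esub> t s' u) \<oplus>\<^bsub>T\<^esub> (t p v \<oplus>\<^bsub>T\<^esub> t p w') = (t q u' \<oplus>\<^bsub>T\<^esub> t s u') \<oplus>\<^bsub>T\<^esub> (t p' v \<oplus>\<^bsub>T\<^esub> t p' w)"
proof -
  have "(t q u \<oplus>\<^bsub>T\<^esub> t s' u) \<oplus>\<^bsub>T\<^esub> (t p v \<oplus>\<^bsub>T\<^esub> t p w') = (t p' u \<oplus>\<^bsub>T\<^esub> t p' u) \<oplus>\<^bsub>T\<^esub> (t p u' \<oplus>\<^bsub>T\<^esub> t p u')"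
    by (simp only: pure_tensor_sum_left[OF s(2)] pure_tensor_sum_right[OF w(2)] assms(1-10))
  also have "\<dots> = (t p u' \<oplus>\<^bsub>T\<^esub> t p u') \<oplus>\<^bsub>T\<^esub> (t p' u \<oplus>\<^bsub>T\<^esub> t p' u)"
    using assms(1-10) by (intro T.a_comm T.a_closed pure_tensor_closed)
  also have "\<dots> = (t q u' \<oplus>\<^bsub>T\<^esub> t s u') \<oplus>\<^bsub>T\<^esub> (t p' v \<oplus>\<^bsub>T\<^esub> t p' w)"
    by (simp only: pure_tensor_sum_left[OF s(1)] pure_tensor_sum_right[OF w(1)] assms(1-10))
  finally show ?thesis .
qed

end

locale tensor_operations = transposed_novikov_poisson_pair +
  fixes dot circ
  assumes tensor_dot: "is_tensor_dot R A\<^sub>1 dot\<^sub>1 A\<^sub>2 dot\<^sub>2 dot"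
    and tensor_circ: "is_tensor_circ R A\<^sub>1 dot\<^sub>1 circ\<^sub>1 A\<^sub>2 dot\<^sub>2 circ\<^sub>2 circ"
begin

lemma bilinear_tensor_dot: "bilinear_map R T T T dot"
  and tensor_dot_pure: "\<lbrakk>a \<in> carrier A\<^sub>1; b \<in> carrier A\<^sub>2; c \<in> carrier A\<^sub>1; d \<in> carrier A\<^sub>2\<rbrakk>
      \<Longrightarrow> dot (t a b) (t c d) = t (dot\<^sub>1 a c) (dot\<^sub>2 b d)"
  using tensor_dot by (simp_all add: is_tensor_dot_def Let_def)

lemma bilinear_tensor_circ: "bilinear_map R T T T circ"
  and tensor_circ_pure: "\<lbrakk>a \<in> carrier A\<^sub>1; b \<in> carrier A\<^sub>2; c \<in> carrier A\<^sub>1; d \<in> carrier A\<^sub>2\<rbrakk>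
      \<Longrightarrow> circ (t a b) (t c d) = t (dot\<^sub>1 a c) (circ\<^sub>2 b d) \<oplus>\<^bsub>T\<^esub> t (circ\<^sub>1 a c) (dot\<^sub>2 b d)"
  using tensor_circ by (simp_all add: is_tensor_circ_def Let_def)

lemmas tensor_op_simps = tensor_dot_pure tensor_circ_pure
  bilinear_mapD(1-3)[OF bilinear_tensor_dot] bilinear_mapD(1-3)[OF bilinear_tensor_circ]

lemma tensor_dot_comm:
  assumes x: "x \<in> carrier T" and y: "y \<in> carrier T"
  shows "dot x y = dot y x"
proof -
  have pure: "dot (t a b) y = dot y (t a b)" if "a \<in> carrier A\<^sub>1" "b \<in> carrier A\<^sub>2" for a b
    using y by (induction rule: tensor_induct)
      (use that in \<open>simp_all add: tensor_op_simps A\<^sub>1.comm[of a] A\<^sub>2.comm[of b]\<close>)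
  show ?thesis
    using x by (induction rule: tensor_induct) (use pure y in \<open>simp_all add: tensor_op_simps\<close>)
qed

lemma tensor_dot_assoc:
  assumes "x \<in> carrier T" "y \<in> carrier T" "z \<in> carrier T"
  shows "dot (dot x y) z = dot x (dot y z)"
  by (rule triadditive_eqI[OF
        triadditive_compose_left[OF bilinear_tensor_dot bilinear_tensor_dot]
        triadditive_compose_right[OF bilinear_tensor_dot bilinear_tensor_dot] _ assms])
    (simp add: tensor_op_simps A\<^sub>1.assoc A\<^sub>2.assoc)

lemma tensor_circ_right_comm:
  assumes "x \<in> carrier T" "y \<in> carrier T" "z \<in> carrier T"
  shows "circ (circ x y) z = circ (circ x z) y"
proof (rule triadditive_eqI[OF
      triadditive_compose_left[OF bilinear_tensor_circ bilinear_tensor_circ]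
      triadditive_swap23[OF triadditive_compose_left[OF bilinear_tensor_circ bilinear_tensor_circ]]
      _ assms])
  fix a b c d e k
  assume [simp]: "a \<in> carrier A\<^sub>1" "b \<in> carrier A\<^sub>2" "c \<in> carrier A\<^sub>1" "d \<in> carrier A\<^sub>2"
    "e \<in> carrier A\<^sub>1" "k \<in> carrier A\<^sub>2"
  show "circ (circ (t a b) (t c d)) (t e k) = circ (circ (t a b) (t e k)) (t c d)"
    by (simp add: tensor_op_simps A\<^sub>1.dot_left_commute[of a e c] A\<^sub>2.dot_left_commute[of b k d]
        A\<^sub>1.right_comm[of a e c] A\<^sub>2.right_comm[of b k d]
        A\<^sub>1.dot_circ[of a e c] A\<^sub>2.dot_circ[of b k d]
        A\<^sub>1.dot_circ_right_comm[OF char, of a e c] A\<^sub>2.dot_circ_right_comm[OF char, of b k d])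
qed

lemma tensor_dot_circ:
  assumes "x \<in> carrier T" "y \<in> carrier T" "z \<in> carrier T"
  shows "circ (dot x y) z = circ (dot x z) y"
proof (rule triadditive_eqI[OF
      triadditive_compose_left[OF bilinear_tensor_circ bilinear_tensor_dot]
      triadditive_swap23[OF triadditive_compose_left[OF bilinear_tensor_circ bilinear_tensor_dot]]
      _ assms])
  fix a b c d e k
  assume [simp]: "a \<in> carrier A\<^sub>1" "b \<in> carrier A\<^sub>2" "c \<in> carrier A\<^sub>1" "d \<in> carrier A\<^sub>2"
    "e \<in> carrier A\<^sub>1" "k \<in> carrier A\<^sub>2"
  show "circ (dot (t a b) (t c d)) (t e k) = circ (dot (t a b) (t e k)) (t c d)"
    by (simp add: tensor_op_simps A\<^sub>1.dot_left_commute[of a e c] A\<^sub>2.dot_left_commute[of b k d]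
        A\<^sub>1.dot_circ[of a e c] A\<^sub>2.dot_circ[of b k d])
qed

lemma tensor_compat:
  assumes "x \<in> carrier T" "y \<in> carrier T" "z \<in> carrier T"
  shows "dot (circ x y) z \<oplus>\<^bsub>T\<^esub> dot (circ x y) z = circ (dot x z) y \<oplus>\<^bsub>T\<^esub> circ x (dot y z)"
proof (rule triadditive_eqI[OF
      triadditive_add[OF T.abelian_group_axioms
        triadditive_compose_left[OF bilinear_tensor_dot bilinear_tensor_circ]
        triadditive_compose_left[OF bilinear_tensor_dot bilinear_tensor_circ]]
      triadditive_add[OF T.abelian_group_axioms
        triadditive_swap23[OF triadditive_compose_left[OF bilinear_tensor_circ bilinear_tensor_dot]]
        triadditive_compose_right[OF bilinear_tensor_circ bilinear_tensor_dot]] _ assms])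
  fix a b c d e k
  assume [simp]: "a \<in> carrier A\<^sub>1" "b \<in> carrier A\<^sub>2" "c \<in> carrier A\<^sub>1" "d \<in> carrier A\<^sub>2"
    "e \<in> carrier A\<^sub>1" "k \<in> carrier A\<^sub>2"
  let ?p1 = "dot\<^sub>1 (circ\<^sub>1 a c) e" and ?p2 = "dot\<^sub>2 (circ\<^sub>2 b d) k"
  let ?m1 = "dot\<^sub>1 (dot\<^sub>1 a c) e" and ?m2 = "dot\<^sub>2 (dot\<^sub>2 b d) k"
  let ?q1 = "circ\<^sub>1 (dot\<^sub>1 a c) e" and ?q2 = "circ\<^sub>2 (dot\<^sub>2 b d) k"
  let ?s1 = "circ\<^sub>1 a (dot\<^sub>1 c e)" and ?s2 = "circ\<^sub>2 b (dot\<^sub>2 d k)"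
  have "dot (circ (t a b) (t c d)) (t e k) \<oplus>\<^bsub>T\<^esub> dot (circ (t a b) (t c d)) (t e k)
      = (t ?m1 ?p2 \<oplus>\<^bsub>T\<^esub> t ?m1 ?p2) \<oplus>\<^bsub>T\<^esub> (t ?p1 ?m2 \<oplus>\<^bsub>T\<^esub> t ?p1 ?m2)"
    by (simp add: tensor_op_simps T.a_ac)
  also have "t ?m1 ?p2 \<oplus>\<^bsub>T\<^esub> t ?m1 ?p2 = t ?m1 ?q2 \<oplus>\<^bsub>T\<^esub> t ?m1 ?s2"
    by (rule pure_tensor_sum_right[OF A\<^sub>2.dot_circ_sum[symmetric]]) simp_all
  also have "t ?p1 ?m2 \<oplus>\<^bsub>T\<^esub> t ?p1 ?m2 = t ?q1 ?m2 \<oplus>\<^bsub>T\<^esub> t ?s1 ?m2"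
    by (rule pure_tensor_sum_left[OF A\<^sub>1.dot_circ_sum[symmetric]]) simp_all
  also have "(t ?m1 ?q2 \<oplus>\<^bsub>T\<^esub> t ?m1 ?s2) \<oplus>\<^bsub>T\<^esub> (t ?q1 ?m2 \<oplus>\<^bsub>T\<^esub> t ?s1 ?m2)
      = (t ?m1 ?q2 \<oplus>\<^bsub>T\<^esub> t ?q1 ?m2) \<oplus>\<^bsub>T\<^esub> (t ?m1 ?s2 \<oplus>\<^bsub>T\<^esub> t ?s1 ?m2)"
    by (simp add: T.a_ac)
  also have "\<dots> = circ (dot (t a b) (t e k)) (t c d) \<oplus>\<^bsub>T\<^esub> circ (t a b) (dot (t c d) (t e k))"
    by (simp add: tensor_op_simps A\<^sub>1.dot_left_commute[of a e c] A\<^sub>2.dot_left_commute[of b k d]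
        A\<^sub>1.dot_circ[of a e c] A\<^sub>2.dot_circ[of b k d] A\<^sub>1.assoc[of a c e] A\<^sub>2.assoc[of b d k])
  finally show "dot (circ (t a b) (t c d)) (t e k) \<oplus>\<^bsub>T\<^esub> dot (circ (t a b) (t c d)) (t e k)
      = circ (dot (t a b) (t e k)) (t c d) \<oplus>\<^bsub>T\<^esub> circ (t a b) (dot (t c d) (t e k))" .
qed

text \<open>
  Left symmetry is stated with sums in place of differences, so that only addition occurs. On
  pure tensors each side has eight terms. Four of them have \<open>x y z\<close> as one factor and
  reduce, in two pairs, to left symmetry in the other factor; the remaining four are
  handled by \<open>cross_terms\<close>.
\<close>

lemma tensor_circ_left_symm:
  assumes "x \<in> carrier T" "y \<in> carrier T" "z \<in> carrier T"
  shows "circ (circ x y) z \<oplus>\<^bsub>T\<^esub> circ y (circ x z) = circ (circ y x) z \<oplus>\<^bsub>T\<^esub> circ x (circ y z)"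
proof (rule triadditive_eqI[OF
      triadditive_add[OF T.abelian_group_axioms
        triadditive_compose_left[OF bilinear_tensor_circ bilinear_tensor_circ]
        triadditive_swap12[OF triadditive_compose_right[OF bilinear_tensor_circ bilinear_tensor_circ]]]
      triadditive_add[OF T.abelian_group_axioms
        triadditive_swap12[OF triadditive_compose_left[OF bilinear_tensor_circ bilinear_tensor_circ]]
        triadditive_compose_right[OF bilinear_tensor_circ bilinear_tensor_circ]] _ assms])
  fix a b c d e k
  assume [simp]: "a \<in> carrier A\<^sub>1" "b \<in> carrier A\<^sub>2" "c \<in> carrier A\<^sub>1" "d \<in> carrier A\<^sub>2"
    "e \<in> carrier A\<^sub>1" "k \<in> carrier A\<^sub>2"
  let ?x = "t a b" and ?y = "t c d" and ?z = "t e k"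
  define m1 m2 where "m1 = dot\<^sub>1 (dot\<^sub>1 a c) e" and "m2 = dot\<^sub>2 (dot\<^sub>2 b d) k"
  define q1 q2 where "q1 = circ\<^sub>1 (dot\<^sub>1 a c) e" and "q2 = circ\<^sub>2 (dot\<^sub>2 b d) k"
  define p1 p1' where "p1 = dot\<^sub>1 (circ\<^sub>1 a c) e" and "p1' = dot\<^sub>1 (circ\<^sub>1 c a) e"
  define p2 p2' where "p2 = dot\<^sub>2 (circ\<^sub>2 b d) k" and "p2' = dot\<^sub>2 (circ\<^sub>2 d b) k"
  define s1 s1' where "s1 = circ\<^sub>1 a (dot\<^sub>1 c e)" and "s1' = circ\<^sub>1 c (dot\<^sub>1 a e)"
  define s2 s2' where "s2 = circ\<^sub>2 b (dot\<^sub>2 d k)" and "s2' = circ\<^sub>2 d (dot\<^sub>2 b k)"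
  note defs = m1_def m2_def q1_def q2_def p1_def p1'_def p2_def p2'_def s1_def s1'_def s2_def s2'_def
  have [simp]: "m1 \<in> carrier A\<^sub>1" "q1 \<in> carrier A\<^sub>1" "p1 \<in> carrier A\<^sub>1" "p1' \<in> carrier A\<^sub>1"
      "s1 \<in> carrier A\<^sub>1" "s1' \<in> carrier A\<^sub>1"
      "m2 \<in> carrier A\<^sub>2" "q2 \<in> carrier A\<^sub>2" "p2 \<in> carrier A\<^sub>2" "p2' \<in> carrier A\<^sub>2"
      "s2 \<in> carrier A\<^sub>2" "s2' \<in> carrier A\<^sub>2"
    by (simp_all add: defs)
  have m1: "dot\<^sub>1 (dot\<^sub>1 c a) e = m1" "dot\<^sub>1 a (dot\<^sub>1 c e) = m1" "dot\<^sub>1 c (dot\<^sub>1 a e) = m1"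
    by (simp_all add: m1_def A\<^sub>1.comm[of c a] A\<^sub>1.assoc[symmetric])
  have m2: "dot\<^sub>2 (dot\<^sub>2 d b) k = m2" "dot\<^sub>2 b (dot\<^sub>2 d k) = m2" "dot\<^sub>2 d (dot\<^sub>2 b k) = m2"
    by (simp_all add: m2_def A\<^sub>2.comm[of d b] A\<^sub>2.assoc[symmetric])
  have q: "circ\<^sub>1 (dot\<^sub>1 c a) e = q1" "circ\<^sub>2 (dot\<^sub>2 d b) k = q2"
    by (simp_all add: q1_def q2_def A\<^sub>1.comm[of c a] A\<^sub>2.comm[of d b])
  have p: "dot\<^sub>1 c (circ\<^sub>1 a e) = p1" "dot\<^sub>1 a (circ\<^sub>1 c e) = p1'"
      "dot\<^sub>2 d (circ\<^sub>2 b k) = p2" "dot\<^sub>2 b (circ\<^sub>2 d k) = p2'"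
    by (simp_all add: p1_def p1'_def p2_def p2'_def A\<^sub>1.comm[of _ "circ\<^sub>1 _ e"] A\<^sub>2.comm[of _ "circ\<^sub>2 _ k"]
        A\<^sub>1.dot_circ_right_comm[OF char, of _ e] A\<^sub>2.dot_circ_right_comm[OF char, of _ k])
  let ?l1 = "circ\<^sub>1 (circ\<^sub>1 a c) e" and ?l1' = "circ\<^sub>1 (circ\<^sub>1 c a) e"
  let ?r1 = "circ\<^sub>1 a (circ\<^sub>1 c e)" and ?r1' = "circ\<^sub>1 c (circ\<^sub>1 a e)"
  let ?l2 = "circ\<^sub>2 (circ\<^sub>2 b d) k" and ?l2' = "circ\<^sub>2 (circ\<^sub>2 d b) k"
  let ?r2 = "circ\<^sub>2 b (circ\<^sub>2 d k)" and ?r2' = "circ\<^sub>2 d (circ\<^sub>2 b k)"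
  have sums: "q1 \<oplus>\<^bsub>A\<^sub>1\<^esub> s1 = p1 \<oplus>\<^bsub>A\<^sub>1\<^esub> p1" "q1 \<oplus>\<^bsub>A\<^sub>1\<^esub> s1' = p1' \<oplus>\<^bsub>A\<^sub>1\<^esub> p1'"
      "q2 \<oplus>\<^bsub>A\<^sub>2\<^esub> s2 = p2 \<oplus>\<^bsub>A\<^sub>2\<^esub> p2" "q2 \<oplus>\<^bsub>A\<^sub>2\<^esub> s2' = p2' \<oplus>\<^bsub>A\<^sub>2\<^esub> p2'"
    using A\<^sub>1.dot_circ_sum[of a c e] A\<^sub>1.dot_circ_sum[of c a e]
      A\<^sub>2.dot_circ_sum[of b d k] A\<^sub>2.dot_circ_sum[of d b k]
    by (simp_all add: q) (simp_all add: defs)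
  have cross: "(t q1 p2 \<oplus>\<^bsub>T\<^esub> t s1' p2) \<oplus>\<^bsub>T\<^esub> (t p1 q2 \<oplus>\<^bsub>T\<^esub> t p1 s2')
      = (t q1 p2' \<oplus>\<^bsub>T\<^esub> t s1 p2') \<oplus>\<^bsub>T\<^esub> (t p1' q2 \<oplus>\<^bsub>T\<^esub> t p1' s2)"
    by (rule cross_terms) (simp_all add: sums)
  have diag1: "t ?l1 m2 \<oplus>\<^bsub>T\<^esub> t ?r1' m2 = t ?l1' m2 \<oplus>\<^bsub>T\<^esub> t ?r1 m2"
    by (rule pure_tensor_sum_left[OF A\<^sub>1.circ_left_symm_sum]) simp_all
  have diag2: "t m1 ?l2 \<oplus>\<^bsub>T\<^esub> t m1 ?r2' = t m1 ?l2' \<oplus>\<^bsub>T\<^esub> t m1 ?r2"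
    by (rule pure_tensor_sum_right[OF A\<^sub>2.circ_left_symm_sum]) simp_all
  have "circ (circ ?x ?y) ?z \<oplus>\<^bsub>T\<^esub> circ ?y (circ ?x ?z)
      = ((t m1 ?l2 \<oplus>\<^bsub>T\<^esub> t q1 p2) \<oplus>\<^bsub>T\<^esub> (t p1 q2 \<oplus>\<^bsub>T\<^esub> t ?l1 m2)) \<oplus>\<^bsub>T\<^esub>
        ((t m1 ?r2' \<oplus>\<^bsub>T\<^esub> t s1' p2) \<oplus>\<^bsub>T\<^esub> (t p1 s2' \<oplus>\<^bsub>T\<^esub> t ?r1' m2))"
    by (simp add: tensor_op_simps m1 m2 p) (simp add: defs)
  also have "\<dots> = (t m1 ?l2 \<oplus>\<^bsub>T\<^esub> t m1 ?r2') \<oplus>\<^bsub>T\<^esub> (t ?l1 m2 \<oplus>\<^bsub>T\<^esub> t ?r1' m2) \<oplus>\<^bsub>T\<^esub>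
      ((t q1 p2 \<oplus>\<^bsub>T\<^esub> t s1' p2) \<oplus>\<^bsub>T\<^esub> (t p1 q2 \<oplus>\<^bsub>T\<^esub> t p1 s2'))"
    by (simp add: T.a_ac)
  also have "\<dots> = (t m1 ?l2' \<oplus>\<^bsub>T\<^esub> t m1 ?r2) \<oplus>\<^bsub>T\<^esub> (t ?l1' m2 \<oplus>\<^bsub>T\<^esub> t ?r1 m2) \<oplus>\<^bsub>T\<^esub>
      ((t q1 p2' \<oplus>\<^bsub>T\<^esub> t s1 p2') \<oplus>\<^bsub>T\<^esub> (t p1' q2 \<oplus>\<^bsub>T\<^esub> t p1' s2))"
    by (simp only: cross diag1 diag2)
  also have "\<dots> = ((t m1 ?l2' \<oplus>\<^bsub>T\<^esub> t q1 p2') \<oplus>\<^bsub>T\<^esub> (t p1' q2 \<oplus>\<^bsub>T\<^esub> t ?l1' m2)) \<oplus>\<^bsub>T\<^esub>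
        ((t m1 ?r2 \<oplus>\<^bsub>T\<^esub> t s1 p2') \<oplus>\<^bsub>T\<^esub> (t p1' s2 \<oplus>\<^bsub>T\<^esub> t ?r1 m2))"
    by (simp add: T.a_ac)
  also have "\<dots> = circ (circ ?y ?x) ?z \<oplus>\<^bsub>T\<^esub> circ ?x (circ ?y ?z)"
    by (simp add: tensor_op_simps m1 m2 p q) (simp add: defs)
  finally show "circ (circ ?x ?y) ?z \<oplus>\<^bsub>T\<^esub> circ ?y (circ ?x ?z)
      = circ (circ ?y ?x) ?z \<oplus>\<^bsub>T\<^esub> circ ?x (circ ?y ?z)" .
qed

lemma tensor_transposed_novikov_poisson: "transposed_novikov_poisson R T dot circ"
proof -
  note circ_closed = bilinear_mapD(1)[OF bilinear_tensor_circ]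
  note dot_closed = bilinear_mapD(1)[OF bilinear_tensor_dot]
  have alg: "nonunital_algebra R T f" if "bilinear_map R T T T f" for f
    by (intro nonunital_algebra.intro nonunital_algebra_axioms.intro
        A\<^sub>1.field_axioms T.module_axioms that)
  have "comm_assoc_algebra R T dot"
    by (intro comm_assoc_algebra.intro comm_assoc_algebra_axioms.intro alg bilinear_tensor_dot
        tensor_dot_comm tensor_dot_assoc)
  moreover have "novikov_algebra R T circ"
    by (intro novikov_algebra.intro novikov_algebra_axioms.intro alg bilinear_tensor_circ
        tensor_circ_right_comm iffD2[OF T.minus_eq_minus_iff] tensor_circ_left_symm circ_closed)
  moreover have "[(2::nat)] \<cdot>\<^bsub>T\<^esub> dot z (circ x y) = circ (dot z x) y \<oplus>\<^bsub>T\<^esub> circ x (dot z y)"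
    if "x \<in> carrier T" "y \<in> carrier T" "z \<in> carrier T" for x y z
  proof -
    have "[(2::nat)] \<cdot>\<^bsub>T\<^esub> dot z (circ x y) = dot (circ x y) z \<oplus>\<^bsub>T\<^esub> dot (circ x y) z"
      using T.two_add_pow[OF dot_closed[OF that(3) circ_closed[OF that(1,2)]]]
        tensor_dot_comm[OF that(3) circ_closed[OF that(1,2)]] by simp
    also have "\<dots> = circ (dot x z) y \<oplus>\<^bsub>T\<^esub> circ x (dot y z)" by (rule tensor_compat[OF that])
    also have "\<dots> = circ (dot z x) y \<oplus>\<^bsub>T\<^esub> circ x (dot z y)"
      by (simp only: tensor_dot_comm[OF that(3,1)] tensor_dot_comm[OF that(3,2)])
    finally show ?thesis .
  qed
  ultimately show ?thesis
    by (intro transposed_novikov_poisson.intro transposed_novikov_poisson_axioms.intro tensor_dot_circ)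
qed

end

theorem proposition2p23:
  fixes R :: "('k, 'r) ring_scheme"
    and A\<^sub>1 :: "('k, 'a, 'm) module_scheme" and dot\<^sub>1 circ\<^sub>1 :: "'a \<Rightarrow> 'a \<Rightarrow> 'a"
    and A\<^sub>2 :: "('k, 'b, 'n) module_scheme" and dot\<^sub>2 circ\<^sub>2 :: "'b \<Rightarrow> 'b \<Rightarrow> 'b"
  assumes "field R" and "ring_char R \<noteq> 2"
    and "transposed_novikov_poisson R A\<^sub>1 dot\<^sub>1 circ\<^sub>1"
    and "transposed_novikov_poisson R A\<^sub>2 dot\<^sub>2 circ\<^sub>2"
  shows "(\<exists>dot. is_tensor_dot R A\<^sub>1 dot\<^sub>1 A\<^sub>2 dot\<^sub>2 dot) \<and>
    (\<exists>circ. is_tensor_circ R A\<^sub>1 dot\<^sub>1 circ\<^sub>1 A\<^sub>2 dot\<^sub>2 circ\<^sub>2 circ) \<and>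
    (\<forall>dot circ.
       is_tensor_dot R A\<^sub>1 dot\<^sub>1 A\<^sub>2 dot\<^sub>2 dot \<longrightarrow>
       is_tensor_circ R A\<^sub>1 dot\<^sub>1 circ\<^sub>1 A\<^sub>2 dot\<^sub>2 circ\<^sub>2 circ \<longrightarrow>
       transposed_novikov_poisson R (tensor_module R A\<^sub>1 A\<^sub>2) dot circ)"
proof -
  have pair: "transposed_novikov_poisson_pair R A\<^sub>1 dot\<^sub>1 circ\<^sub>1 A\<^sub>2 dot\<^sub>2 circ\<^sub>2"
    by (intro transposed_novikov_poisson_pair.intro transposed_novikov_poisson_pair_axioms.intro assms)
  have "transposed_novikov_poisson R (tensor_module R A\<^sub>1 A\<^sub>2) dot circ"
    if "is_tensor_dot R A\<^sub>1 dot\<^sub>1 A\<^sub>2 dot\<^sub>2 dot"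
      and "is_tensor_circ R A\<^sub>1 dot\<^sub>1 circ\<^sub>1 A\<^sub>2 dot\<^sub>2 circ\<^sub>2 circ" for dot circ
    by (rule tensor_operations.tensor_transposed_novikov_poisson[OF
          tensor_operations.intro[OF pair tensor_operations_axioms.intro[OF that]]])
  then show ?thesis
    using transposed_novikov_poisson_pair.ex_tensor_dot[OF pair]
      transposed_novikov_poisson_pair.ex_tensor_circ[OF pair] by simp
qed

end
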